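(* For every integer $\tau\ge2$ there is a finite shape $S_\tau\subseteq\mathbb{Z}^2$ such that $\mathrm{dtc}_\tau(S_\tau)<\mathrm{dtc}_{\tau'}(S_\tau)$ for every integer temperature $1\le\tau'\le\tau-1$.
   Context: Abstract Tile Assembly Model. A shape is a set $S\subseteq\mathbb{Z}^2$ whose grid graph (adjacent = Euclidean distance 1) is connected. A tile type is a quadruple of glue labels on its north, west, south, east sides. An assembly is a partial function $\mathbb{Z}^2\dashrightarrow T$. A strength function $g$ assigns each glue label a value in $\mathbb{N}_0$; adjacent tiles whose abutting sides carry the same label $\ell$ with $g(\ell)>0$ interact with strength $g(\ell)$. An assembly is $\tau$-stable if every cut of its binding graph has total strength at least $\tau$. A TAS is $(T,\sigma,g,\tau)$ with $T$ a finite set of tile types, $\sigma$ a single-tile seed (all TASs are singly-seeded), and integer temperature $\tau\ge1$. An assembly grows by adding one tile so that the result is $\tau$-stable; producible assemblies are those obtained from $\sigma$ by finitely many such steps; terminal ones are producible assemblies to which no tile can be added. The TAS is directed if for any two producible assemblies there is a producible assembly that both produce, and it strictly self-assembles $S$ if every terminal assembly has domain $S$. The directed tile complexity at temperature $\tau$ is $\mathrm{dtc}_\tau(S)=\min\{|T|: (T,\sigma,g,\tau)\text{ is a directed TAS strictly self-assembling } S\}$.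
   Formalization: "Strictly self-assembles S" also requires that a terminal assembly exists; otherwise a directed one-tile system growing an infinite line would vacuously assemble every shape, giving tile complexity 1 at every temperature and making the claim false. *)

theory Defs
  imports Main "HOL-Library.Extended_Nat"
begin

type_synonym pos = "int \<times> int"

definition adjacent :: "pos \<Rightarrow> pos \<Rightarrow> bool" where
  "adjacent p q \<longleftrightarrow> (fst p - fst q)\<^sup>2 + (snd p - snd q)\<^sup>2 = 1"

text \<open>The empty set is vacuously connected, but no system assembles it since the seed is
  always present.\<close>

definition shape :: "pos set \<Rightarrow> bool" where
  "shape S \<longleftrightarrow>
     (\<forall>p\<in>S. \<forall>q\<in>S. (\<lambda>u v. u \<in> S \<and> v \<in> S \<and> adjacent u v)\<^sup>*\<^sup>* p q)"

text \<open>Tile sets are finite, so a countably infinite supply of labels is no restriction.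
  Labels of strength 0 never bind.\<close>

type_synonym glue = nat

datatype tile_type = Tile (north: glue) (west: glue) (south: glue) (east: glue)

type_synonym assembly = "pos \<Rightarrow> tile_type option"

record tas =
  tiles :: "tile_type set"
  seed :: assembly
  strength :: "glue \<Rightarrow> nat"
  temperature :: nat

definition is_tas :: "tas \<Rightarrow> bool" where
  "is_tas \<T> \<longleftrightarrow> finite (tiles \<T>) \<and> (\<exists>p. \<exists>t\<in>tiles \<T>. seed \<T> = [p \<mapsto> t])
     \<and> 1 \<le> temperature \<T>"

definition match_strength :: "(glue \<Rightarrow> nat) \<Rightarrow> glue \<Rightarrow> glue \<Rightarrow> nat" where
  "match_strength g a b = (if a = b then g a else 0)"

text \<open>The weight of the edge between \<open>p\<close> and \<open>q\<close> in the binding graph, 0 if there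
  is no edge. East and north are the directions of increasing first and second coordinate.\<close>

definition bond :: "(glue \<Rightarrow> nat) \<Rightarrow> assembly \<Rightarrow> pos \<Rightarrow> pos \<Rightarrow> nat" where
  "bond g \<alpha> p q =
     (case (\<alpha> p, \<alpha> q) of
        (Some s, Some t) \<Rightarrow>
          (if q = (fst p + 1, snd p) then match_strength g (east s) (west t)
           else if q = (fst p - 1, snd p) then match_strength g (west s) (east t)
           else if q = (fst p, snd p + 1) then match_strength g (north s) (south t)
           else if q = (fst p, snd p - 1) then match_strength g (south s) (north t)
           else 0)
      | _ \<Rightarrow> 0)"

text \<open>The sums below are meaningful only for assemblies with finite domain. All assemblies that
  arise by growth from a seed are of this kind, see \<open>producible_finite\<close>.\<close>

definition stable :: "(glue \<Rightarrow> nat) \<Rightarrow> nat \<Rightarrow> assembly \<Rightarrow> bool" where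
  "stable g \<tau> \<alpha> \<longleftrightarrow>
     (\<forall>A B. A \<union> B = dom \<alpha> \<and> A \<inter> B = {} \<and> A \<noteq> {} \<and> B \<noteq> {}
        \<longrightarrow> \<tau> \<le> (\<Sum>p\<in>A. \<Sum>q\<in>B. bond g \<alpha> p q))"

definition grow :: "tas \<Rightarrow> assembly \<Rightarrow> assembly \<Rightarrow> bool" where
  "grow \<T> \<alpha> \<beta> \<longleftrightarrow>
     (\<exists>p t. p \<notin> dom \<alpha> \<and> t \<in> tiles \<T> \<and> \<beta> = \<alpha>(p \<mapsto> t)
        \<and> stable (strength \<T>) (temperature \<T>) \<beta>)"

abbreviation produces :: "tas \<Rightarrow> assembly \<Rightarrow> assembly \<Rightarrow> bool" where
  "produces \<T> \<equiv> (grow \<T>)\<^sup>*\<^sup>*"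

definition producible :: "tas \<Rightarrow> assembly \<Rightarrow> bool" where
  "producible \<T> \<alpha> \<longleftrightarrow> produces \<T> (seed \<T>) \<alpha>"

definition terminal :: "tas \<Rightarrow> assembly \<Rightarrow> bool" where
  "terminal \<T> \<alpha> \<longleftrightarrow> producible \<T> \<alpha> \<and> (\<nexists>\<beta>. grow \<T> \<alpha> \<beta>)"

lemma producible_finite:
  assumes "is_tas \<T>" and "producible \<T> \<alpha>"
  shows "finite (dom \<alpha>)"
  using assms(2) unfolding producible_def
proof (induction rule: rtranclp_induct)
  case base
  then show ?case using assms(1) by (auto simp: is_tas_def simp del: fun_upd_apply)
next
  case (step \<alpha> \<beta>)
  then show ?case by (auto simp: grow_def simp del: fun_upd_apply)
qed

definition directed :: "tas \<Rightarrow> bool" where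
  "directed \<T> \<longleftrightarrow>
     (\<forall>\<alpha> \<beta>. producible \<T> \<alpha> \<and> producible \<T> \<beta>
        \<longrightarrow> (\<exists>\<gamma>. producible \<T> \<gamma> \<and> produces \<T> \<alpha> \<gamma> \<and> produces \<T> \<beta> \<gamma>))"

text \<open>Producible assemblies are finite here, so a system that grows forever may have no terminal
  assembly. The first conjunct keeps such a system from assembling every shape vacuously.
  For directed systems and finite \<open>S\<close> it makes the definition agree with the usual one in which
  limits of infinite growth sequences also count as producible: if a terminal assembly exists,
  directedness lets every producible assembly grow into it. For infinite \<open>S\<close> the definition is
  never satisfied.\<close>

definition strictly_self_assembles :: "tas \<Rightarrow> pos set \<Rightarrow> bool" where
  "strictly_self_assembles \<T> S \<longleftrightarrow>
     (\<exists>\<alpha>. terminal \<T> \<alpha>) \<and> (\<forall>\<alpha>. terminal \<T> \<alpha> \<longrightarrow> dom \<alpha> = S)"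

text \<open>The infimum is a minimum when some system qualifies, and \<open>\<infinity>\<close> otherwise.\<close>

definition dtc :: "nat \<Rightarrow> pos set \<Rightarrow> enat" where
  "dtc \<tau> S =
     (INF \<T> \<in> {\<T>. is_tas \<T> \<and> temperature \<T> = \<tau> \<and> directed \<T> \<and> strictly_self_assembles \<T> S}.
        enat (card (tiles \<T>)))"

end

theory Submission
  imports Defs "HOL-Library.Nat_Bijection"
begin

text \<open>
  Put \<open>k = \<tau> - 1\<close>. The shape consists of a base line carrying many \<open>gadgets\<close>, in which long
  vertical arms of \<open>2 k + 1\<close> kinds \<open>W\<^sub>1, \<dots>, W\<^sub>k, E\<^sub>1, \<dots>, E\<^sub>k, C\<close> meet, from west, east and
  south, around a common cell, the site. The site belongs to the shape around \<open>W\<^sub>i, E\<^sub>i\<close> and around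
  \<open>W\<^sub>i, E\<^sub>i\<^sub>+\<^sub>1, C\<close>, but not around \<open>W\<^sub>i, E\<^sub>i\<^sub>+\<^sub>1\<close>, around \<open>W\<^sub>i, C\<close> or around \<open>E\<^sub>i, C\<close>.

  Suppose that all arms of one kind end in the same tile type, and let \<open>x\<^sub>i\<close>, \<open>y\<^sub>i\<close> be the strengths of
  the glues that \<open>W\<^sub>i\<close> and \<open>E\<^sub>i\<close> show to a site. Then \<open>x\<^sub>i + y\<^sub>i \<ge> \<tau>'\<close> and \<open>x\<^sub>i + y\<^sub>i\<^sub>+\<^sub>1 < \<tau>'\<close>, where \<open>\<tau>'\<close>
  is the temperature: the third arm \<open>C\<close> shows that some tile type matches both glues. So
  \<open>0 < x\<^sub>1 < \<dots> < x\<^sub>k < \<tau>'\<close>, which forces \<open>\<tau>' > k\<close>. At temperature \<open>\<tau>\<close> the choice \<open>x\<^sub>i = i\<close>,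
  \<open>y\<^sub>i = \<tau> - i\<close> and strength 1 for \<open>C\<close> works, and arms of the same kind share their tile types.

  An arm that has grown from the base line and shares a tile type with another such arm in its lower
  part agrees with it from there on. Hence, if two arms of the same kind end differently, there are
  \<open>2 k + 2\<close> arms without common tile types in their lower parts. The length of the arms can be chosen
  so large, compared to the number of gadgets, that this costs more tile types than the system at
  temperature \<open>\<tau>\<close> has. Every gadget occurs twice, so that one copy is free of the seed.
\<close>

section \<open>Growth by single tiles\<close>

datatype dir = North | West | South | East

fun opp :: "dir \<Rightarrow> dir" where
  "opp North = South" | "opp South = North" | "opp West = East" | "opp East = West"

fun step :: "dir \<Rightarrow> pos \<Rightarrow> pos" where
  "step North (x, y) = (x, y + 1)" | "step South (x, y) = (x, y - 1)"
| "step West (x, y) = (x - 1, y)" | "step East (x, y) = (x + 1, y)"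

fun side :: "dir \<Rightarrow> tile_type \<Rightarrow> glue" where
  "side North t = north t" | "side South t = south t"
| "side West t = west t" | "side East t = east t"

lemma UNIV_dir: "(UNIV :: dir set) = {North, West, South, East}"
  using dir.exhaust by auto

instance dir :: finite
  by standard (simp add: UNIV_dir)

lemma opp_opp [simp]: "opp (opp d) = d"
  by (cases d) auto

lemma step_opp [simp]: "step (opp d) (step d p) = p" "step d (step (opp d) p) = p"
  by (cases d; cases p; simp)+

lemma step_neq [simp]: "step d p \<noteq> p" "p \<noteq> step d p"
  by (cases d; cases p; simp)+

lemma inj_step: "inj (\<lambda>d. step d p)"
proof (rule injI)
  fix d e assume "step d p = step e p"
  then show "d = e" by (cases d; cases e; cases p) auto
qed

lemma step_eq_iff [simp]: "step d p = step e p \<longleftrightarrow> d = e"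
  using inj_step unfolding inj_def by blast

lemma adjacent_step: "adjacent p q \<longleftrightarrow> (\<exists>d. q = step d p)"
proof
  assume a: "adjacent p q"
  obtain x y u v where p: "p = (x, y)" and q: "q = (u, v)"
    by (cases p; cases q) auto
  have sq: "(x - u)\<^sup>2 + (y - v)\<^sup>2 = 1" using a by (simp add: adjacent_def p q)
  have "(x - u)\<^sup>2 \<le> 1" "(y - v)\<^sup>2 \<le> 1"
    using sq zero_le_power2[of "x - u"] zero_le_power2[of "y - v"] by linarith+
  then have "x - u = -1 \<or> x - u = 0 \<or> x - u = 1" "y - v = -1 \<or> y - v = 0 \<or> y - v = 1"
    by (auto simp only: abs_square_le_1)
  then have "(u, v) = step North p \<or> (u, v) = step South p \<or> (u, v) = step West p \<or> (u, v) = step East p"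
    using sq by (elim disjE) (simp_all add: p algebra_simps)
  then show "\<exists>d. q = step d p" by (auto simp: q)
next
  assume "\<exists>d. q = step d p"
  then obtain d where "q = step d p" ..
  then show "adjacent p q" by (cases d; cases p) (auto simp: adjacent_def)
qed

definition pull :: "(glue \<Rightarrow> nat) \<Rightarrow> assembly \<Rightarrow> tile_type \<Rightarrow> pos \<Rightarrow> dir \<Rightarrow> nat" where
  "pull g \<alpha> t p d =
     (case \<alpha> (step d p) of None \<Rightarrow> 0 | Some s \<Rightarrow> match_strength g (side d t) (side (opp d) s))"

definition attach :: "(glue \<Rightarrow> nat) \<Rightarrow> assembly \<Rightarrow> tile_type \<Rightarrow> pos \<Rightarrow> nat" where
  "attach g \<alpha> t p = (\<Sum>d\<in>UNIV. pull g \<alpha> t p d)"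

lemma attach_alt:
  "attach g \<alpha> t p = pull g \<alpha> t p North + pull g \<alpha> t p West + pull g \<alpha> t p South + pull g \<alpha> t p East"
  by (simp add: attach_def UNIV_dir)

lemma pull_le_attach: "pull g \<alpha> t p d \<le> attach g \<alpha> t p"
  unfolding attach_def by (rule member_le_sum) auto

lemma bond_sym: "bond g \<alpha> p q = bond g \<alpha> q p"
proof -
  obtain x y u v where p: "p = (x, y)" and q: "q = (u, v)" by (cases p; cases q) auto
  show ?thesis
    unfolding bond_def p q match_strength_def by (auto split: option.splits)
qed

lemma bond_step: "\<alpha> p = Some t \<Longrightarrow> bond g \<alpha> p (step d p) = pull g \<alpha> t p d"
  by (cases d; cases p) (auto simp: bond_def pull_def split: option.splits)

lemma bond_nonzero: "bond g \<alpha> p q \<noteq> 0 \<Longrightarrow> q \<in> range (\<lambda>d. step d p)"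
  by (cases p; cases q)
    (auto simp: bond_def UNIV_dir image_iff split: option.splits if_splits)

lemma sum_bond_attach:
  assumes "finite (dom \<alpha>)" "p \<notin> dom \<alpha>"
  shows "(\<Sum>q\<in>dom \<alpha>. bond g (\<alpha>(p \<mapsto> t)) p q) = attach g \<alpha> t p"
proof -
  let ?b = "bond g (\<alpha>(p \<mapsto> t)) p" and ?R = "range (\<lambda>d. step d p)"
  have fin: "finite ?R" by simp
  have out: "?b q = 0" if "q \<notin> dom \<alpha>" "q \<in> ?R" for q
    using that by (auto simp: bond_def dom_def split: option.splits)
  have "sum ?b (dom \<alpha>) = sum ?b (dom \<alpha> \<inter> ?R)"
    using bond_nonzero[of g "\<alpha>(p \<mapsto> t)" p] assms by (intro sum.mono_neutral_right) blast+
  also have "\<dots> = sum ?b ?R"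
    using out fin by (intro sum.mono_neutral_left) (simp, blast, metis DiffE IntI)
  also have "\<dots> = (\<Sum>d\<in>UNIV. ?b (step d p))"
    by (subst sum.reindex[OF inj_step]) simp
  also have "\<dots> = attach g \<alpha> t p"
    unfolding attach_def
  proof (rule sum.cong[OF refl])
    fix d
    have "?b (step d p) = pull g (\<alpha>(p \<mapsto> t)) t p d" by (rule bond_step) simp
    then show "?b (step d p) = pull g \<alpha> t p d" by (simp add: pull_def)
  qed
  finally show ?thesis .
qed

text \<open>The cut that isolates \<open>p\<close> has weight \<open>attach\<close>. Any other cut
  restricts to a cut of the old assembly, which is heavy enough already, and bonds at
  \<open>p\<close> can only add weight. So a condition on all cuts becomes a condition on the four
  neighbours of the new cell.\<close>

lemma stable_fun_upd:
  assumes fin: "finite (dom \<alpha>)" and ne: "dom \<alpha> \<noteq> {}" and p: "p \<notin> dom \<alpha>" and st: "stable g \<tau> \<alpha>"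
  shows "stable g \<tau> (\<alpha>(p \<mapsto> t)) \<longleftrightarrow> \<tau> \<le> attach g \<alpha> t p"
proof
  let ?\<beta> = "\<alpha>(p \<mapsto> t)"
  assume "stable g \<tau> ?\<beta>"
  moreover have "{p} \<union> dom \<alpha> = dom ?\<beta>" "{p} \<inter> dom \<alpha> = {}" using p by auto
  ultimately have "\<tau> \<le> (\<Sum>u\<in>{p}. \<Sum>q\<in>dom \<alpha>. bond g ?\<beta> u q)"
    using ne unfolding stable_def by blast
  then show "\<tau> \<le> attach g \<alpha> t p" using sum_bond_attach[OF fin p, of g t] by simp
next
  let ?\<beta> = "\<alpha>(p \<mapsto> t)"
  assume att: "\<tau> \<le> attach g \<alpha> t p"
  have main: "\<tau> \<le> (\<Sum>u\<in>A. \<Sum>q\<in>B. bond g ?\<beta> u q)"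
    if AB: "A \<union> B = dom ?\<beta>" "A \<inter> B = {}" "A \<noteq> {}" "B \<noteq> {}" and pA: "p \<in> A" for A B
  proof (cases "A = {p}")
    case True
    then have "B = dom \<alpha>" using AB p by auto
    then show ?thesis using True att sum_bond_attach[OF fin p, of g t] by simp
  next
    case False
    let ?A = "A - {p}"
    have AB': "?A \<union> B = dom \<alpha>" "?A \<inter> B = {}" "?A \<noteq> {}" using AB pA False p by auto
    have finA: "finite A" using AB fin by (metis finite_Un finite_insert dom_fun_upd option.distinct(1))
    have "\<tau> \<le> (\<Sum>u\<in>?A. \<Sum>q\<in>B. bond g \<alpha> u q)"
      using st AB' AB(4) unfolding stable_def by blast
    also have "\<dots> = (\<Sum>u\<in>?A. \<Sum>q\<in>B. bond g ?\<beta> u q)"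
    proof (intro sum.cong refl)
      fix u q assume "u \<in> ?A" "q \<in> B"
      then have "u \<noteq> p" "q \<noteq> p" using AB pA by auto
      then show "bond g \<alpha> u q = bond g ?\<beta> u q" by (simp add: bond_def)
    qed
    also have "\<dots> \<le> (\<Sum>u\<in>A. \<Sum>q\<in>B. bond g ?\<beta> u q)"
      using finA by (intro sum_mono2) auto
    finally show ?thesis .
  qed
  show "stable g \<tau> ?\<beta>"
    unfolding stable_def
  proof (intro allI impI, elim conjE)
    fix A B assume AB: "A \<union> B = dom ?\<beta>" "A \<inter> B = {}" "A \<noteq> {}" "B \<noteq> {}"
    show "\<tau> \<le> (\<Sum>u\<in>A. \<Sum>q\<in>B. bond g ?\<beta> u q)"
    proof (cases "p \<in> A")
      case True
      then show ?thesis using main AB by blast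
    next
      case False
      \<comment> \<open>Bonds are symmetric, so the two sides of the cut may be exchanged.\<close>
      then have "p \<in> B" using AB by auto
      then have "\<tau> \<le> (\<Sum>u\<in>B. \<Sum>q\<in>A. bond g ?\<beta> u q)"
        using AB by (intro main) (simp_all only: Un_commute Int_commute not_False_eq_True)
      also have "\<dots> = (\<Sum>q\<in>A. \<Sum>u\<in>B. bond g ?\<beta> q u)"
        by (subst sum.swap) (intro sum.cong refl bond_sym)
      finally show ?thesis .
    qed
  qed
qed

lemma producible_stable:
  assumes T: "is_tas \<T>" and "producible \<T> \<alpha>"
  shows "stable (strength \<T>) (temperature \<T>) \<alpha> \<and> dom \<alpha> \<noteq> {}"
  using assms(2) unfolding producible_def
proof (induction rule: rtranclp_induct)
  case base
  obtain p t where "seed \<T> = [p \<mapsto> t]" using T by (auto simp: is_tas_def)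
  then have d: "dom (seed \<T>) = {p}" by simp
  have no_cut: "False" if "A \<union> B = {p}" "A \<inter> B = {}" "A \<noteq> {}" "B \<noteq> {}" for A B :: "pos set"
    using that by (metis Int_absorb singleton_Un_iff)
  show ?case unfolding stable_def d using no_cut by (simp, metis)
next
  case (step \<alpha> \<beta>)
  then show ?case by (auto simp: grow_def simp del: fun_upd_apply)
qed

lemma grow_iff:
  assumes "is_tas \<T>" "producible \<T> \<alpha>"
  shows "grow \<T> \<alpha> \<beta> \<longleftrightarrow> (\<exists>p t. p \<notin> dom \<alpha> \<and> t \<in> tiles \<T> \<and> \<beta> = \<alpha>(p \<mapsto> t)
     \<and> temperature \<T> \<le> attach (strength \<T>) \<alpha> t p)"
proof -
  have "stable (strength \<T>) (temperature \<T>) (\<alpha>(p \<mapsto> t))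
      \<longleftrightarrow> temperature \<T> \<le> attach (strength \<T>) \<alpha> t p" if "p \<notin> dom \<alpha>" for p t
    using stable_fun_upd[OF producible_finite[OF assms]] producible_stable[OF assms] that by blast
  then show ?thesis unfolding grow_def by blast
qed

lemma producible_grow: "producible \<T> \<alpha> \<Longrightarrow> grow \<T> \<alpha> \<beta> \<Longrightarrow> producible \<T> \<beta>"
  unfolding producible_def by (rule rtranclp.rtrancl_into_rtrancl)

lemma producible_tiles:
  assumes "is_tas \<T>" "producible \<T> \<alpha>"
  shows "ran \<alpha> \<subseteq> tiles \<T>"
  using assms(2) unfolding producible_def
proof (induction rule: rtranclp_induct)
  case base
  then obtain p t where "t \<in> tiles \<T>" "seed \<T> = [p \<mapsto> t]" using assms(1) by (auto simp: is_tas_def)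
  then show ?case using ran_map_upd[of Map.empty p t] by (simp del: fun_upd_apply)
next
  case (step \<alpha> \<beta>)
  then obtain p t where "p \<notin> dom \<alpha>" "t \<in> tiles \<T>" "\<beta> = \<alpha>(p \<mapsto> t)" unfolding grow_def by blast
  then show ?case using step.IH ran_map_upd[of \<alpha> p t] by (simp del: fun_upd_apply add: domIff)
qed

lemma produces_mono: "produces \<T> \<alpha> \<beta> \<Longrightarrow> \<alpha> \<subseteq>\<^sub>m \<beta>"
proof (induction rule: rtranclp_induct)
  case (step \<beta> \<gamma>)
  from step(2) have "\<beta> \<subseteq>\<^sub>m \<gamma>"
    unfolding grow_def by (metis map_le_def domIff fun_upd_other)
  then show ?case using step(3) map_le_trans by blast
qed simp

section \<open>Directed systems and orders of growth\<close>

lemma pull_dom: "pull g \<beta> t p d \<noteq> 0 \<Longrightarrow> step d p \<in> dom \<beta>"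
  by (cases "\<beta> (step d p)") (simp_all add: pull_def domI)

lemma terminal_produces:
  assumes "terminal \<T> \<alpha>" "produces \<T> \<alpha> \<beta>"
  shows "\<beta> = \<alpha>"
  using assms(2)
proof (cases rule: converse_rtranclpE)
  case (step \<gamma>)
  then show ?thesis using assms(1) unfolding terminal_def by blast
qed simp

text \<open>By \<open>unique\<close> every producible assembly is a part of \<open>\<A>\<close>, and
  by \<open>progress\<close> each of them can be completed to \<open>\<A>\<close>, which is
  therefore the only terminal assembly. The invariant \<open>I\<close> serves to exclude growth in a
  wrong order.\<close>

lemma directed_self_assemblyI:
  fixes \<T> :: tas and \<A> :: assembly
  assumes T: "is_tas \<T>" and seed: "seed \<T> = [p0 \<mapsto> t0]" and A0: "\<A> p0 = Some t0"
    and fin: "finite (dom \<A>)" and ran: "ran \<A> \<subseteq> tiles \<T>"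
    and I0: "I (seed \<T>)"
    and unique: "\<And>\<beta> p t. \<lbrakk>I \<beta>; \<beta> \<subseteq>\<^sub>m \<A>; p \<notin> dom \<beta>; t \<in> tiles \<T>;
        temperature \<T> \<le> attach (strength \<T>) \<beta> t p\<rbrakk> \<Longrightarrow> \<A> p = Some t \<and> I (\<beta>(p \<mapsto> t))"
    and progress: "\<And>\<beta>. \<lbrakk>\<beta> \<subseteq>\<^sub>m \<A>; p0 \<in> dom \<beta>; dom \<beta> \<noteq> dom \<A>\<rbrakk> \<Longrightarrow>
        \<exists>p t. p \<notin> dom \<beta> \<and> \<A> p = Some t \<and> temperature \<T> \<le> attach (strength \<T>) \<beta> t p"
  shows "directed \<T> \<and> strictly_self_assembles \<T> (dom \<A>)"
proof -
  have inv: "I \<beta> \<and> \<beta> \<subseteq>\<^sub>m \<A> \<and> p0 \<in> dom \<beta>" if "producible \<T> \<beta>" for \<beta>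
    using that unfolding producible_def
  proof (induction rule: rtranclp_induct)
    case base
    show ?case using I0 A0 by (simp add: seed map_le_def del: fun_upd_apply) simp
  next
    case (step \<beta> \<gamma>)
    have "producible \<T> \<beta>" using step by (simp add: producible_def)
    then obtain p t where pt: "p \<notin> dom \<beta>" "t \<in> tiles \<T>" "\<gamma> = \<beta>(p \<mapsto> t)"
      "temperature \<T> \<le> attach (strength \<T>) \<beta> t p"
      using step(2) grow_iff[OF T] by blast
    have "\<A> p = Some t \<and> I \<gamma>" using unique[of \<beta> p t] step.IH pt by blast
    then show ?case using step.IH unfolding pt(3) map_le_def
      by (metis domIff dom_fun_upd fun_upd_apply insertI2 option.distinct(1))
  qed
  have reach: "produces \<T> \<beta> \<A>" if "producible \<T> \<beta>" for \<beta>
    using that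
  proof (induction "card (dom \<A> - dom \<beta>)" arbitrary: \<beta> rule: less_induct)
    case less
    have le: "\<beta> \<subseteq>\<^sub>m \<A>" and p0: "p0 \<in> dom \<beta>" using inv[OF less.prems] by auto
    show ?case
    proof (cases "dom \<beta> = dom \<A>")
      case True
      then have "\<A> \<subseteq>\<^sub>m \<beta>" using le unfolding map_le_def by metis
      then have "\<beta> = \<A>" using le by (simp add: map_le_antisym)
      then show ?thesis by simp
    next
      case False
      obtain p t where pt: "p \<notin> dom \<beta>" "\<A> p = Some t"
        "temperature \<T> \<le> attach (strength \<T>) \<beta> t p"
        using progress[OF le p0 False] by blast
      have t: "t \<in> tiles \<T>" using pt(2) ran by (meson ranI subsetD)
      have g: "grow \<T> \<beta> (\<beta>(p \<mapsto> t))" using grow_iff[OF T less.prems] pt t by blast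
      have "dom \<A> - dom (\<beta>(p \<mapsto> t)) \<subset> dom \<A> - dom \<beta>" using pt by auto
      then have "card (dom \<A> - dom (\<beta>(p \<mapsto> t))) < card (dom \<A> - dom \<beta>)"
        by (rule psubset_card_mono[rotated]) (use fin in simp)
      then have "produces \<T> (\<beta>(p \<mapsto> t)) \<A>"
        using less.hyps producible_grow[OF less.prems g] by blast
      then show ?thesis using g by (meson converse_rtranclp_into_rtranclp)
    qed
  qed
  have A: "producible \<T> \<A>"
    using reach[of "seed \<T>"] unfolding producible_def by blast
  have tml: "terminal \<T> \<A>"
  proof -
    have "\<not> grow \<T> \<A> \<beta>" for \<beta>
    proof
      assume "grow \<T> \<A> \<beta>"
      then obtain p t where "p \<notin> dom \<A>" "\<beta> = \<A>(p \<mapsto> t)" "producible \<T> \<beta>"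
        using producible_grow[OF A] unfolding grow_def by blast
      moreover from this(3) have "dom \<beta> \<subseteq> dom \<A>" using inv map_le_implies_dom_le by blast
      ultimately show False by (simp add: domIff)
    qed
    then show ?thesis using A by (simp add: terminal_def)
  qed
  have "dom \<beta> = dom \<A>" if "terminal \<T> \<beta>" for \<beta>
  proof -
    have "produces \<T> \<beta> \<A>" using that reach unfolding terminal_def by blast
    then have "\<A> = \<beta>" by (rule terminal_produces[OF that])
    then show ?thesis by simp
  qed
  then show ?thesis
    unfolding directed_def strictly_self_assembles_def using reach A tml by blast
qed

text \<open>An order of growth: \<open>tm p\<close> is the time at which the cell \<open>p\<close> is filled.\<close>

lemma growth_order:
  assumes T: "is_tas \<T>" and seed: "seed \<T> = [s \<mapsto> t0]" and "producible \<T> \<alpha>"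
  shows "\<exists>tm :: pos \<Rightarrow> nat. (\<forall>p\<in>dom \<alpha>. tm p < card (dom \<alpha>)) \<and> (\<forall>p\<in>dom \<alpha>. p \<noteq> s \<longrightarrow>
      producible \<T> (\<alpha> |` {q. tm q < tm p}) \<and>
      temperature \<T> \<le> attach (strength \<T>) (\<alpha> |` {q. tm q < tm p}) (the (\<alpha> p)) p)"
  using assms(3) unfolding producible_def
proof (induction rule: rtranclp_induct)
  case base
  show ?case by (rule exI[of _ "\<lambda>_. 0"]) (simp add: seed del: fun_upd_apply)
next
  case (step \<alpha> \<beta>)
  have prod: "producible \<T> \<alpha>" using step by (simp add: producible_def)
  obtain p t where pt: "p \<notin> dom \<alpha>" "\<beta> = \<alpha>(p \<mapsto> t)"
    "temperature \<T> \<le> attach (strength \<T>) \<alpha> t p"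
    using step(2) grow_iff[OF T prod] by blast
  obtain tm where tm: "\<And>q. q \<in> dom \<alpha> \<Longrightarrow> tm q < card (dom \<alpha>)"
    "\<And>q. q \<in> dom \<alpha> \<Longrightarrow> q \<noteq> s \<Longrightarrow> produces \<T> (seed \<T>) (\<alpha> |` {u. tm u < tm q}) \<and>
      temperature \<T> \<le> attach (strength \<T>) (\<alpha> |` {u. tm u < tm q}) (the (\<alpha> q)) q"
    using step.IH by blast
  define N where "N = card (dom \<alpha>)"
  \<comment> \<open>All earlier times are below \<open>card (dom \<alpha>)\<close>, so
    \<open>N\<close> is later than each of them. Outside \<open>dom \<alpha>\<close> the values of
    \<open>tm\<close> are arbitrary and harmless, since the restricted assemblies are undefined
    there.\<close>
  let ?tm = "tm(p := N)"
  have card: "card (dom \<beta>) = Suc N"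
    using pt(1) producible_finite[OF T prod] by (simp add: pt(2) N_def)
  have new: "\<beta> |` {u. ?tm u < ?tm p} = \<alpha>"
  proof
    fix u show "(\<beta> |` {u. ?tm u < ?tm p}) u = \<alpha> u"
      using pt(1) tm(1)[of u] by (cases "u \<in> dom \<alpha>") (auto simp: restrict_map_def pt(2) N_def domIff)
  qed
  have old: "\<beta> |` {u. ?tm u < ?tm q} = \<alpha> |` {u. tm u < tm q}" if "q \<in> dom \<alpha>" for q
  proof
    fix u show "(\<beta> |` {u. ?tm u < ?tm q}) u = (\<alpha> |` {u. tm u < tm q}) u"
      using that pt(1) tm(1)[OF that] by (auto simp: restrict_map_def pt(2) N_def domIff)
  qed
  have "\<forall>q\<in>dom \<beta>. ?tm q < card (dom \<beta>)"
    unfolding card using tm(1) by (auto simp: pt(2) N_def less_Suc_eq)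
  moreover have "\<forall>q\<in>dom \<beta>. q \<noteq> s \<longrightarrow> produces \<T> (seed \<T>) (\<beta> |` {u. ?tm u < ?tm q}) \<and>
      temperature \<T> \<le> attach (strength \<T>) (\<beta> |` {u. ?tm u < ?tm q}) (the (\<beta> q)) q"
  proof (intro ballI impI)
    fix q assume q: "q \<in> dom \<beta>" "q \<noteq> s"
    show "produces \<T> (seed \<T>) (\<beta> |` {u. ?tm u < ?tm q}) \<and>
      temperature \<T> \<le> attach (strength \<T>) (\<beta> |` {u. ?tm u < ?tm q}) (the (\<beta> q)) q"
    proof (cases "q = p")
      case True
      then show ?thesis unfolding True new using step(1) pt by simp
    next
      case False
      then have "q \<in> dom \<alpha>" using q pt(2) by auto
      then show ?thesis using False tm(2)[of q] q(2) old[of q] by (simp add: pt(2))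
    qed
  qed
  ultimately show ?case by blast
qed

text \<open>A directed system that strictly assembles \<open>S\<close>, with its unique terminal assembly \<open>\<alpha>\<close>,
  seed position \<open>s\<close> and an order of growth.\<close>

locale assembled =
  fixes \<T> :: tas and S :: "pos set" and \<alpha> :: assembly and s :: pos and tm :: "pos \<Rightarrow> nat"
  assumes dom_\<alpha>: "dom \<alpha> = S"
    and in_tiles: "\<alpha> p = Some t \<Longrightarrow> t \<in> tiles \<T>"
    and finite_tiles: "finite (tiles \<T>)"
    and temp_pos: "1 \<le> temperature \<T>"
    and producible_\<alpha>: "producible \<T> \<alpha>"
    and forced: "producible \<T> \<beta> \<Longrightarrow> p \<notin> dom \<beta> \<Longrightarrow> t \<in> tiles \<T> \<Longrightarrow>
      temperature \<T> \<le> attach (strength \<T>) \<beta> t p \<Longrightarrow> \<alpha> p = Some t"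
    and producible_before: "p \<in> S \<Longrightarrow> p \<noteq> s \<Longrightarrow> producible \<T> (\<alpha> |` {q. tm q < tm p})"
    and attach_before: "p \<in> S \<Longrightarrow> p \<noteq> s \<Longrightarrow>
      temperature \<T> \<le> attach (strength \<T>) (\<alpha> |` {q. tm q < tm p}) (the (\<alpha> p)) p"

text \<open>By directedness every producible assembly grows into the terminal one and is thus a part
  of it. Hence a tile that can attach to any producible assembly is the tile of
  \<open>\<alpha>\<close> in that cell, which is \<open>forced\<close>.\<close>

lemma assembledI:
  assumes T: "is_tas \<T>" and dir: "directed \<T>" and ssa: "strictly_self_assembles \<T> S"
  obtains \<alpha> s tm where "assembled \<T> S \<alpha> s tm"
proof -
  obtain \<alpha> where tml: "terminal \<T> \<alpha>" and d: "dom \<alpha> = S"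
    using ssa unfolding strictly_self_assembles_def by blast
  have prod: "producible \<T> \<alpha>" using tml by (simp add: terminal_def)
  obtain s t0 where seed: "seed \<T> = [s \<mapsto> t0]" using T by (auto simp: is_tas_def)
  obtain tm :: "pos \<Rightarrow> nat" where tm: "\<forall>p\<in>dom \<alpha>. p \<noteq> s \<longrightarrow>
      producible \<T> (\<alpha> |` {q. tm q < tm p}) \<and>
      temperature \<T> \<le> attach (strength \<T>) (\<alpha> |` {q. tm q < tm p}) (the (\<alpha> p)) p"
    using growth_order[OF T seed prod] by blast
  have sub: "\<beta> \<subseteq>\<^sub>m \<alpha>" if "producible \<T> \<beta>" for \<beta>
  proof -
    have "\<exists>\<gamma>. producible \<T> \<gamma> \<and> produces \<T> \<beta> \<gamma> \<and> produces \<T> \<alpha> \<gamma>"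
      using dir that prod unfolding directed_def by simp
    then obtain \<gamma> where \<gamma>: "produces \<T> \<beta> \<gamma>" "produces \<T> \<alpha> \<gamma>" by (elim exE conjE)
    have "\<gamma> = \<alpha>" using terminal_produces[OF tml \<gamma>(2)] .
    then show ?thesis using produces_mono \<gamma>(1) by blast
  qed
  have "assembled \<T> S \<alpha> s tm"
  proof
    fix \<beta> p t
    assume b: "producible \<T> \<beta>" "p \<notin> dom \<beta>" "t \<in> tiles \<T>"
      "temperature \<T> \<le> attach (strength \<T>) \<beta> t p"
    then have "grow \<T> \<beta> (\<beta>(p \<mapsto> t))"
      unfolding grow_iff[OF T b(1)] by (intro exI[of _ p] exI[of _ t]) blast
    then have "\<beta>(p \<mapsto> t) \<subseteq>\<^sub>m \<alpha>" by (intro sub producible_grow[OF b(1)])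
    from bspec[OF this[unfolded map_le_def], of p] show "\<alpha> p = Some t" by simp
  next
    fix p t assume "\<alpha> p = Some t"
    then show "t \<in> tiles \<T>" using producible_tiles[OF T prod] by (meson ranI subsetD)
  next
    show "finite (tiles \<T>)" "1 \<le> temperature \<T>" using T by (simp_all add: is_tas_def)
  next
    fix p assume "p \<in> S" "p \<noteq> s"
    then show "producible \<T> (\<alpha> |` {q. tm q < tm p})"
      "temperature \<T> \<le> attach (strength \<T>) (\<alpha> |` {q. tm q < tm p}) (the (\<alpha> p)) p"
      using tm d by blast+
  qed (fact d, fact prod)
  then show ?thesis using that by blast
qed

section \<open>Bonds that suffice on their own, and the copies they force\<close>

context assembled
begin

text \<open>A bond strong enough that either tile could attach to the other without further
  support.\<close>

definition link :: "dir \<Rightarrow> pos \<Rightarrow> bool" where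
  "link d p \<longleftrightarrow> (\<exists>u v. \<alpha> p = Some u \<and> \<alpha> (step d p) = Some v \<and> side d u = side (opp d) v
     \<and> temperature \<T> \<le> strength \<T> (side d u))"

definition fwd :: "dir \<Rightarrow> pos \<Rightarrow> bool" where
  "fwd d p \<longleftrightarrow> link d p \<and> tm p < tm (step d p)"

text \<open>Some producible assembly contains the tile at \<open>q\<close> while the cell
  \<open>step d q\<close> is empty: \<open>\<alpha>\<close> itself if that cell is outside
  \<open>S\<close>, and otherwise the assembly just before the cell was filled. There
  \<open>t\<close> can attach, so it is \<open>forced\<close>.\<close>

lemma forced_link:
  assumes u: "\<alpha> q = Some u" and t: "t \<in> tiles \<T>" and match: "side (opp d) t = side d u"
    and strong: "temperature \<T> \<le> strength \<T> (side d u)"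
    and free: "step d q \<notin> S \<or> (tm q < tm (step d q) \<and> step d q \<noteq> s)"
  shows "\<alpha> (step d q) = Some t"
proof -
  let ?p = "step d q"
  have "\<exists>\<beta>. producible \<T> \<beta> \<and> ?p \<notin> dom \<beta> \<and> \<beta> q = Some u"
  proof (cases "?p \<in> S")
    case False
    then show ?thesis using producible_\<alpha> u dom_\<alpha> by blast
  next
    case True
    then have "producible \<T> (\<alpha> |` {r. tm r < tm ?p})" using free producible_before by blast
    moreover have "(\<alpha> |` {r. tm r < tm ?p}) q = Some u" using True free u by (auto simp: restrict_map_def)
    ultimately show ?thesis by (intro exI[of _ "\<alpha> |` {r. tm r < tm ?p}"]) auto
  qed
  then obtain \<beta> where \<beta>: "producible \<T> \<beta>" "?p \<notin> dom \<beta>" "\<beta> q = Some u" by blast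
  have "pull (strength \<T>) \<beta> t ?p (opp d) = strength \<T> (side d u)"
    using \<beta>(3) match by (simp add: pull_def match_strength_def)
  then have "temperature \<T> \<le> attach (strength \<T>) \<beta> t ?p"
    using strong pull_le_attach[of "strength \<T>" \<beta> t ?p "opp d"] by simp
  then show ?thesis using forced \<beta> t by blast
qed

lemma link_copy:
  assumes "link d p" "\<alpha> p' = \<alpha> p"
    and "step d p' \<notin> S \<or> (tm p' < tm (step d p') \<and> step d p' \<noteq> s)"
  shows "\<alpha> (step d p') = \<alpha> (step d p)"
proof -
  obtain u v where uv: "\<alpha> p = Some u" "\<alpha> (step d p) = Some v" "side d u = side (opp d) v"
     "temperature \<T> \<le> strength \<T> (side d u)"
    using assms(1) by (auto simp: link_def)
  have "v \<in> tiles \<T>" using uv(2) in_tiles by blast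
  then show ?thesis using forced_link[of p' u v d] uv assms by simp
qed

text \<open>Otherwise the repeated tile type would force a tile outside \<open>S\<close>.\<close>

lemma link_copy_in: "link d p \<Longrightarrow> \<alpha> p' = \<alpha> p \<Longrightarrow> step d p' \<in> S"
  using link_copy[of d p p'] dom_\<alpha> unfolding link_def by (metis domI)

text \<open>The cell of \<open>X\<close> that is filled first is supported only by earlier cells
  outside \<open>X\<close>. The only such support is that of \<open>q\<close> by \<open>p\<close>,
  so the first cell is \<open>q\<close>, and its single bond must reach the temperature.\<close>

lemma gate:
  assumes X: "X \<subseteq> S" "s \<notin> X" and q: "q \<in> X" "q = step d p" "p \<notin> X"
    and gate: "\<And>u e. u \<in> X \<Longrightarrow> step e u \<in> S \<Longrightarrow> step e u \<notin> X \<Longrightarrow> tm (step e u) < tm u \<Longrightarrow>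
      u = q \<and> step e u = p"
  shows "fwd d p"
proof -
  obtain u where u: "u \<in> X" "\<And>v. v \<in> X \<Longrightarrow> tm u \<le> tm v"
    using ex_has_least_nat[of "\<lambda>v. v \<in> X" q tm] q(1) by blast
  have uS: "u \<in> S" "u \<noteq> s" using u X by auto
  let ?\<beta> = "\<alpha> |` {r. tm r < tm u}"
  obtain v where v: "\<alpha> u = Some v" using uS dom_\<alpha> by blast
  have early: "u = q \<and> step e u = p \<and> tm p < tm q" if "step e u \<in> dom ?\<beta>" for e
  proof -
    have "step e u \<in> S" "tm (step e u) < tm u" using that dom_\<alpha> by auto
    moreover from this have "step e u \<notin> X" using u(2)[of "step e u"] by linarith
    ultimately show ?thesis using gate u(1) by blast
  qed
  have att: "temperature \<T> \<le> attach (strength \<T>) ?\<beta> v u" using attach_before[OF uS] v by simp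
  then have "attach (strength \<T>) ?\<beta> v u \<noteq> 0" using temp_pos by linarith
  then obtain e where e: "pull (strength \<T>) ?\<beta> v u e \<noteq> 0"
    unfolding attach_def by (meson sum.neutral)
  then have "step e u \<in> dom ?\<beta>" by (rule pull_dom)
  note ee = early[OF this]
  have uq: "u = q" and lt: "tm p < tm q" using ee by auto
  have step: "step (opp d) u = p" using uq q(2) by simp
  have pull0: "pull (strength \<T>) ?\<beta> v u e' = 0" if "e' \<noteq> opp d" for e'
  proof (rule ccontr)
    assume "pull (strength \<T>) ?\<beta> v u e' \<noteq> 0"
    then have "step e' u \<in> dom ?\<beta>" by (rule pull_dom)
    then have "step e' u = step (opp d) u" using early step by metis
    then show False using that by simp
  qed
  have "attach (strength \<T>) ?\<beta> v u = (\<Sum>e'\<in>{opp d}. pull (strength \<T>) ?\<beta> v u e')"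
    unfolding attach_def by (rule sum.mono_neutral_right) (simp_all add: pull0)
  then have strong: "temperature \<T> \<le> pull (strength \<T>) ?\<beta> v u (opp d)" using att by simp
  have "?\<beta> p = \<alpha> p" using lt uq by simp
  moreover obtain w where w: "\<alpha> p = Some w"
    using dom_\<alpha> ee \<open>step e u \<in> dom ?\<beta>\<close> by auto
  ultimately have w2: "pull (strength \<T>) ?\<beta> v u (opp d)
      = match_strength (strength \<T>) (side (opp d) v) (side d w)"
    using step by (simp add: pull_def)
  have "side (opp d) v = side d w" "temperature \<T> \<le> strength \<T> (side d w)"
    using strong temp_pos w2 by (auto simp: match_strength_def split: if_splits)
  then have "link d p" using w v uq q(2) by (auto simp: link_def)
  then show ?thesis using lt q(2) by (simp add: fwd_def)
qed

end

section \<open>The shape\<close>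

datatype arm = ArmW int | ArmE int | ArmC

definition cell :: "int \<Rightarrow> int \<Rightarrow> int \<Rightarrow> pos" where
  "cell n r y = (9 * n + r, y)"

lemma step_cell [simp]:
  "step North (cell n r y) = cell n r (y + 1)" "step South (cell n r y) = cell n r (y - 1)"
  "step West (cell n r y) = cell n (r - 1) y" "step East (cell n r y) = cell n (r + 1) y"
  by (simp_all add: cell_def)

lemma cell_eq_iff [simp]: "cell n r y = cell n r' y' \<longleftrightarrow> r = r' \<and> y = y'"
  by (simp add: cell_def)

lemma cell_cases:
  obtains n r y where "p = cell n r y" "0 \<le> r" "r < 9"
proof -
  obtain x y where "p = (x, y)" by (cases p)
  then have "p = cell (x div 9) (x mod 9) y" by (simp add: cell_def)
  then show ?thesis using that[of "x div 9" "x mod 9" y] by simp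
qed

text \<open>
  Gadget \<open>n\<close> occupies the columns \<open>9 n, \<dots>, 9 n + 8\<close>, and \<open>cell n r y\<close> is its cell in column \<open>9 n + r\<close>
  and row \<open>y\<close>. Its arms are of the kinds \<open>ArmW (w n)\<close> and \<open>ArmE (e n)\<close>, where 0 means that there is no
  such arm, and of the kind \<open>ArmC\<close> if \<open>c n\<close>. It contains its site if \<open>f n\<close>. Since \<open>n0\<close> is arbitrary in
  the \<open>exists\<close> assumptions, there are at least two gadgets of every sort.
\<close>

locale layout =
  fixes k b M :: int and w e :: "int \<Rightarrow> int" and c f :: "int \<Rightarrow> bool"
  assumes k: "1 \<le> k" and b: "5 \<le> b" and M: "0 < M"
    and gadgets: "0 \<le> n \<Longrightarrow> n < M \<Longrightarrow>
      (\<exists>i. 1 \<le> i \<and> i \<le> k \<and> (w n = i \<and> e n = i \<and> \<not> c n \<and> f n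
        \<or> w n = i \<and> e n = 0 \<and> c n \<and> \<not> f n \<or> w n = 0 \<and> e n = i \<and> c n \<and> \<not> f n))
      \<or> (\<exists>i. 1 \<le> i \<and> i < k \<and> w n = i \<and> e n = i + 1 \<and> (c n \<longleftrightarrow> f n))"
    and exists_A: "1 \<le> i \<Longrightarrow> i \<le> k \<Longrightarrow> \<exists>n. 0 \<le> n \<and> n < M \<and> n \<noteq> n0 \<and> w n = i \<and> e n = i \<and> \<not> c n \<and> f n"
    and exists_P: "1 \<le> i \<Longrightarrow> i \<le> k \<Longrightarrow> \<exists>n. 0 \<le> n \<and> n < M \<and> n \<noteq> n0 \<and> w n = i \<and> e n = 0 \<and> c n \<and> \<not> f n"
    and exists_Q: "1 \<le> i \<Longrightarrow> i \<le> k \<Longrightarrow> \<exists>n. 0 \<le> n \<and> n < M \<and> n \<noteq> n0 \<and> w n = 0 \<and> e n = i \<and> c n \<and> \<not> f n"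
    and exists_B: "1 \<le> i \<Longrightarrow> i < k \<Longrightarrow> \<exists>n. 0 \<le> n \<and> n < M \<and> n \<noteq> n0 \<and> w n = i \<and> e n = i + 1 \<and> c n \<and> f n"
    and exists_D: "1 \<le> i \<Longrightarrow> i < k \<Longrightarrow> \<exists>n. 0 \<le> n \<and> n < M \<and> n \<noteq> n0 \<and> w n = i \<and> e n = i + 1 \<and> \<not> c n \<and> \<not> f n"
begin

text \<open>
  An arm is a vertical column with a horizontal bump at one height. The bumps of the west and east
  arms, of two cells each, reach the site in row \<open>b\<close>, and the length of the columns above them tells
  the kinds apart. The central arm reaches the site with its top. Its bump has a single cell and
  marks the distance to the top: without it, a central arm could fill the site by growing one cell
  further.
\<close>

definition occ :: "int \<Rightarrow> int \<Rightarrow> int \<Rightarrow> bool" where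
  "occ n r y \<longleftrightarrow> r = 1 \<and> 0 < w n \<and> 1 \<le> y \<and> y \<le> b + w n \<or> (r = 2 \<or> r = 3) \<and> 0 < w n \<and> y = b
    \<or> r = 7 \<and> 0 < e n \<and> 1 \<le> y \<and> y \<le> b + e n \<or> (r = 5 \<or> r = 6) \<and> 0 < e n \<and> y = b
    \<or> r = 4 \<and> c n \<and> 1 \<le> y \<and> y < b \<or> r = 5 \<and> c n \<and> y = b - 3 \<or> r = 4 \<and> f n \<and> y = b"

definition S :: "pos set" where
  "S = {(x, y). 0 \<le> x \<and> x < 9 * M \<and> (y = 0 \<or> occ (x div 9) (x mod 9) y)}"

lemma cell_in_S:
  assumes "0 \<le> r" "r < 9"
  shows "cell n r y \<in> S \<longleftrightarrow> 0 \<le> n \<and> n < M \<and> (y = 0 \<or> occ n r y)"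
proof -
  have "(9 * n + r) div 9 = n" "(9 * n + r) mod 9 = r" using assms by auto
  moreover have "0 \<le> 9 * n + r \<longleftrightarrow> 0 \<le> n" "9 * n + r < 9 * M \<longleftrightarrow> n < M" using assms by linarith+
  ultimately show ?thesis by (simp add: S_def cell_def)
qed

lemma indices: "0 \<le> n \<Longrightarrow> n < M \<Longrightarrow> 0 \<le> w n \<and> w n \<le> k \<and> 0 \<le> e n \<and> e n \<le> k"
  using gadgets[of n] by linarith

lemma occ_bound: "occ n r y \<Longrightarrow> w n \<le> k \<Longrightarrow> e n \<le> k \<Longrightarrow> 0 \<le> y \<and> y \<le> b + k"
  using b k unfolding occ_def by linarith

lemma finite_S: "finite S"
proof (rule finite_subset)
  show "S \<subseteq> {0..<9 * M} \<times> {0..b + k}"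
  proof (rule subrelI)
    fix x y assume "(x, y) \<in> S"
    then have x: "0 \<le> x" "x < 9 * M" and y: "y = 0 \<or> occ (x div 9) (x mod 9) y" by (auto simp: S_def)
    have "0 \<le> x div 9" "x div 9 < M" using x by auto
    then have "0 \<le> y \<and> y \<le> b + k"
      using y occ_bound[of "x div 9" "x mod 9" y] indices[of "x div 9"] b k by auto
    then show "(x, y) \<in> {0..<9 * M} \<times> {0..b + k}" using x by simp
  qed
qed simp

fun has :: "int \<Rightarrow> arm \<Rightarrow> bool" where
  "has n (ArmW i) \<longleftrightarrow> 0 < i \<and> w n = i" | "has n (ArmE i) \<longleftrightarrow> 0 < i \<and> e n = i" | "has n ArmC \<longleftrightarrow> c n"

fun off :: "arm \<Rightarrow> int" where
  "off (ArmW i) = 1" | "off (ArmE i) = 7" | "off ArmC = 4"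

fun height :: "arm \<Rightarrow> int" where
  "height (ArmW i) = b + i" | "height (ArmE i) = b + i" | "height ArmC = b - 1"

fun bend :: "arm \<Rightarrow> int" where
  "bend (ArmW i) = b" | "bend (ArmE i) = b" | "bend ArmC = b - 3"

fun bdir :: "arm \<Rightarrow> dir" where
  "bdir (ArmW i) = East" | "bdir (ArmE i) = West" | "bdir ArmC = East"

text \<open>The cell in which an arm touches the site \<open>cell n 4 b\<close> of its gadget.\<close>

fun contact :: "int \<Rightarrow> arm \<Rightarrow> pos" where
  "contact n (ArmW i) = cell n 3 b" | "contact n (ArmE i) = cell n 5 b"
| "contact n ArmC = cell n 4 (b - 1)"

fun bump :: "int \<Rightarrow> arm \<Rightarrow> pos set" where
  "bump n (ArmW i) = {cell n 2 b, cell n 3 b}" | "bump n (ArmE i) = {cell n 6 b, cell n 5 b}"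
| "bump n ArmC = {cell n 5 (b - 3)}"

definition arms :: "arm set" where
  "arms = ArmW ` {1..k} \<union> ArmE ` {1..k} \<union> {ArmC}"

lemma finite_arms: "finite arms" by (simp add: arms_def)

lemma card_arms: "int (card arms) = 2 * k + 1"
proof -
  have "card arms = card (ArmW ` {1..k}) + card (ArmE ` {1..k}) + card {ArmC}"
    unfolding arms_def by (subst card_Un_disjoint; (subst card_Un_disjoint)?) auto
  also have "\<dots> = nat k + nat k + 1"
    by (simp add: card_image inj_on_def)
  finally show ?thesis using k by simp
qed

end

section \<open>The order of growth along an arm\<close>

locale assembled_layout = layout k b M w e c f + assembled \<T> S \<alpha> s tm
  for k b M :: int and w e :: "int \<Rightarrow> int" and c f :: "int \<Rightarrow> bool"
    and \<T> :: tas and \<alpha> :: assembly and s :: pos and tm :: "pos \<Rightarrow> nat"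
begin

text \<open>An arm that does not contain the seed and whose contact cell is filled before the site
  can only have grown upwards from the base line.\<close>

definition regular :: "int \<Rightarrow> arm \<Rightarrow> bool" where
  "regular n a \<longleftrightarrow> 0 \<le> n \<and> n < M \<and> has n a \<and> fst s div 9 \<noteq> n
     \<and> (f n \<longrightarrow> tm (contact n a) < tm (cell n 4 b))"

lemma seed_cell: "fst s div 9 \<noteq> n \<Longrightarrow> 0 \<le> r \<Longrightarrow> r < 9 \<Longrightarrow> s \<noteq> cell n r y"
  by (auto simp: cell_def)

text \<open>Apply \<open>gate\<close> to the part of the arm above row \<open>m\<close>, including
  the bump if it branches off there. This part meets the rest of \<open>S\<close> only at the column
  cell below it and possibly at the site, and regularity makes the site later than the contact
  cell.\<close>

lemma regular_up:
  assumes reg: "regular n a" and m: "0 \<le> m" "m < height a"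
  shows "fwd North (cell n (off a) m)"
proof -
  have n: "0 \<le> n" "n < M" "has n a" and sn: "fst s div 9 \<noteq> n"
    and t: "f n \<Longrightarrow> tm (contact n a) < tm (cell n 4 b)"
    using reg by (auto simp: regular_def)
  let ?X = "(cell n (off a) ` {m<..height a}) \<union> (if m < bend a then bump n a else {})"
  show ?thesis
  proof (rule gate[where X = ?X and q = "cell n (off a) (m + 1)"])
    show "?X \<subseteq> S"
      using n m b by (cases a) (auto simp: cell_in_S occ_def)
    have "s \<noteq> cell n (off a) y" for y by (rule seed_cell[OF sn]) (cases a; simp)+
    moreover have "s \<notin> bump n a" using seed_cell[OF sn] by (cases a) auto
    ultimately show "s \<notin> ?X" by auto
    show "cell n (off a) (m + 1) \<in> ?X" using m by auto
    show "cell n (off a) (m + 1) = step North (cell n (off a) m)" by simp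
    show "cell n (off a) m \<notin> ?X" by (cases a) auto
  next
    fix u d
    assume u: "u \<in> ?X" and v: "step d u \<in> S" "step d u \<notin> ?X" and lt: "tm (step d u) < tm u"
    have t': "\<not> (f n \<and> u = contact n a \<and> step d u = cell n 4 b)"
      using t lt by auto
    have X: "cell n r y \<in> ?X \<longleftrightarrow> r = off a \<and> m < y \<and> y \<le> height a \<or> m < bend a \<and> cell n r y \<in> bump n a"
      for r y by auto
    obtain r y where uc: "u = cell n r y"
      using u by (cases a) (auto split: if_splits)
    have u': "r = off a \<and> m < y \<and> y \<le> height a \<or> m < bend a \<and> cell n r y \<in> bump n a"
      using u unfolding uc X .
    obtain r' y' where vc: "step d u = cell n r' y'" and d:
      "r' = r \<and> (y' = y + 1 \<or> y' = y - 1) \<or> y' = y \<and> (r' = r + 1 \<or> r' = r - 1)"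
      unfolding uc by (cases d) auto
    have r: "1 \<le> r" "r \<le> 7" using u' by (cases a; auto)+
    have "0 \<le> r'" "r' < 9" using d r by auto
    then have v': "y' = 0 \<or> occ n r' y'" using v(1) unfolding vc by (simp add: cell_in_S)
    have x': "\<not> (r' = off a \<and> m < y' \<and> y' \<le> height a)" "\<not> (m < bend a \<and> cell n r' y' \<in> bump n a)"
      using v(2) unfolding vc X by blast+
    have t'': "\<not> (f n \<and> cell n r y = contact n a \<and> cell n r' y' = cell n 4 b)"
      using t' uc vc by metis
    have "r = off a \<and> y = m + 1 \<and> r' = off a \<and> y' = m"
    proof (cases a)
      case (ArmW i)
      have "0 < i" "w n = i" using n ArmW by auto
      then show ?thesis using u' v' x' t'' d r m b unfolding ArmW occ_def
        by (simp only: off.simps height.simps bend.simps bump.simps contact.simps cell_eq_iff insert_iff empty_iff) (smt (z3))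
    next
      case (ArmE i)
      have "0 < i" "e n = i" using n ArmE by auto
      then show ?thesis using u' v' x' t'' d r m b unfolding ArmE occ_def
        by (simp only: off.simps height.simps bend.simps bump.simps contact.simps cell_eq_iff insert_iff empty_iff) (smt (z3))
    next
      case ArmC
      have "c n" using n ArmC by auto
      then show ?thesis using u' v' x' t'' d r m b unfolding ArmC occ_def
        by (simp only: off.simps height.simps bend.simps bump.simps contact.simps cell_eq_iff insert_iff empty_iff) (smt (z3))
    qed
    then show "u = cell n (off a) (m + 1) \<and> step d u = cell n (off a) m"
      using uc vc by simp
  qed
qed

text \<open>Again by \<open>gate\<close>: besides its column, the bump can touch only the site,
  which is filled later than the contact cell.\<close>

lemma regular_bend:
  assumes reg: "regular n a"
  shows "fwd (bdir a) (cell n (off a) (bend a))"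
proof -
  have n: "0 \<le> n" "n < M" "has n a" and sn: "fst s div 9 \<noteq> n"
    and t: "f n \<Longrightarrow> tm (contact n a) < tm (cell n 4 b)"
    using reg by (auto simp: regular_def)
  show ?thesis
  proof (rule gate[where X = "bump n a" and q = "step (bdir a) (cell n (off a) (bend a))"])
    show "bump n a \<subseteq> S" using n b by (cases a) (auto simp: cell_in_S occ_def)
    show "s \<notin> bump n a" using seed_cell[OF sn] by (cases a) auto
    show "step (bdir a) (cell n (off a) (bend a)) \<in> bump n a" by (cases a) auto
    show "cell n (off a) (bend a) \<notin> bump n a" by (cases a) auto
  next
    fix u d
    assume u: "u \<in> bump n a" and v: "step d u \<in> S" "step d u \<notin> bump n a"
      and lt: "tm (step d u) < tm u"
    have t': "\<not> (f n \<and> u = contact n a \<and> step d u = cell n 4 b)"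
      using t lt by auto
    show "u = step (bdir a) (cell n (off a) (bend a)) \<and> step d u = cell n (off a) (bend a)"
      using u v t' n b by (cases a; cases d) (auto simp: cell_in_S occ_def)
  qed simp
qed

lemma regular_bump:
  assumes reg: "regular n a" and a: "a \<noteq> ArmC"
  shows "fwd (bdir a) (step (bdir a) (cell n (off a) (bend a)))"
proof -
  have n: "0 \<le> n" "n < M" "has n a" and sn: "fst s div 9 \<noteq> n"
    and t: "f n \<Longrightarrow> tm (contact n a) < tm (cell n 4 b)"
    using reg by (auto simp: regular_def)
  show ?thesis
  proof (rule gate[where X = "{contact n a}" and q = "contact n a"])
    show "{contact n a} \<subseteq> S" using n b by (cases a) (auto simp: cell_in_S occ_def)
    show "s \<notin> {contact n a}" using seed_cell[OF sn] by (cases a) auto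
    show "contact n a = step (bdir a) (step (bdir a) (cell n (off a) (bend a)))"
      using a by (cases a) auto
    show "step (bdir a) (cell n (off a) (bend a)) \<notin> {contact n a}" using a by (cases a) auto
  next
    fix u d
    assume u: "u \<in> {contact n a}" and v: "step d u \<in> S" and lt: "tm (step d u) < tm u"
    have t': "\<not> (f n \<and> u = contact n a \<and> step d u = cell n 4 b)"
      using t lt by auto
    show "u = contact n a \<and> step d u = step (bdir a) (cell n (off a) (bend a))"
      using u v t' n b a by (cases a; cases d) (auto simp: cell_in_S occ_def)
  qed simp
qed

end

section \<open>Low temperatures need many tile types\<close>

context assembled_layout
begin

section \<open>Arms that share a tile type\<close>

lemma regularD:
  assumes "regular n a"
  shows "0 \<le> n" "n < M" "has n a" "fst s div 9 \<noteq> n"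
  using assms by (auto simp: regular_def)

lemma off_range: "0 \<le> off a" "off a < 9" "1 \<le> off a" "off a \<le> 7"
  by (cases a; simp)+

lemma bend_less_height: "has n a \<Longrightarrow> bend a < height a" and bend_ge: "2 \<le> bend a" "b - 3 \<le> bend a"
  using b by (cases a; simp)+

text \<open>Vertical bonds in a regular arm are links pointing upwards. The first arm supplies the
  link; in the second one the next cell is still empty when the copied tile is present.\<close>

lemma copy_up:
  assumes reg: "regular n a" "regular n' a'" and m: "0 \<le> m" "0 \<le> m'"
    and eq: "\<alpha> (cell n (off a) m) = \<alpha> (cell n' (off a') m')"
    and "m + int j \<le> height a" "m' + int j \<le> height a'"
  shows "\<alpha> (cell n (off a) (m + int j)) = \<alpha> (cell n' (off a') (m' + int j))"
  using assms(6,7)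
proof (induction j)
  case 0
  then show ?case using eq by simp
next
  case (Suc j)
  let ?p = "cell n (off a) (m + int j)" and ?p' = "cell n' (off a') (m' + int j)"
  have IH: "\<alpha> ?p' = \<alpha> ?p" using Suc by simp
  have "fwd North ?p" "fwd North ?p'"
    using Suc.prems m by (auto intro!: regular_up reg)
  moreover have "step North ?p' \<noteq> s"
    using seed_cell[OF regularD(4)[OF reg(2)] off_range(1,2)] by (metis step_cell(1))
  ultimately have "\<alpha> (step North ?p') = \<alpha> (step North ?p)"
    by (intro link_copy IH) (auto simp: fwd_def)
  then show ?case by (simp add: algebra_simps)
qed

lemma no_side:
  assumes "regular n a" "1 \<le> y" "y \<le> height a" "d = East \<or> d = West" "y \<noteq> bend a \<or> d \<noteq> bdir a"
  shows "step d (cell n (off a) y) \<notin> S"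
proof -
  have "has n a" using regularD[OF assms(1)] by simp
  with assms(4) show ?thesis
    using assms(2,3,5) b by (elim disjE; cases a) (auto simp: cell_in_S occ_def)
qed

lemma bdir_horizontal: "bdir a = East \<or> bdir a = West"
  by (cases a) auto

text \<open>If \<open>a\<close> bent earlier than \<open>a'\<close> relative to the common tile
  type, then the copy of the bend tile of \<open>a\<close> would force a cell beside the column of
  \<open>a'\<close>, below its bend, where \<open>S\<close> has none. Rows up to
  \<open>b - 4\<close> lie below all bends.\<close>

lemma bend_le:
  assumes reg: "regular n a" "regular n' a'" and m: "1 \<le> m" "1 \<le> m'" "m \<le> b - 4" "m' \<le> b - 4"
    and eq: "\<alpha> (cell n (off a) m) = \<alpha> (cell n' (off a') m')"
  shows "bend a' - m' \<le> bend a - m"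
proof (rule ccontr)
  assume less: "\<not> bend a' - m' \<le> bend a - m"
  define j where "j = nat (bend a - m)"
  have j: "int j = bend a - m" using m bend_ge[of a] by (simp add: j_def)
  have tops: "bend a < height a" "bend a' < height a'"
    using bend_less_height regularD(3) reg by blast+
  have "\<alpha> (cell n (off a) (m + int j)) = \<alpha> (cell n' (off a') (m' + int j))"
    using m tops j less by (intro copy_up reg eq) auto
  then have "step (bdir a) (cell n' (off a') (m' + int j)) \<in> S"
    using regular_bend[OF reg(1)] j by (intro link_copy_in[of _ "cell n (off a) (bend a)"]) (auto simp: fwd_def)
  moreover have "step (bdir a) (cell n' (off a') (m' + int j)) \<notin> S"
    using m tops j less by (intro no_side reg bdir_horizontal) auto
  ultimately show False by simp
qed

text \<open>The tile at the top of the shorter arm also occurs in the longer one, where a link leads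
  further up, so it would force a tile above the shorter arm. The condition
  \<open>bend a = b\<close> excludes the central arm, above whose top the site may belong to
  \<open>S\<close>.\<close>

lemma height_le:
  assumes reg: "regular n a" "regular n' a'" and m: "1 \<le> m" "m \<le> b - 4"
    and eq: "\<alpha> (cell n (off a) m) = \<alpha> (cell n' (off a') m)"
    and less: "bend a = b" "height a < height a'"
  shows False
proof -
  define j where "j = nat (height a - m)"
  have tops: "bend a < height a"
    using bend_less_height regularD(3) reg by blast
  then have j: "int j = height a - m" using m less by (simp add: j_def)
  have "\<alpha> (cell n (off a) (m + int j)) = \<alpha> (cell n' (off a') (m + int j))"
    using m less j by (intro copy_up reg eq) auto
  moreover have "fwd North (cell n' (off a') (height a))"
    using less m tops by (intro regular_up reg) auto
  ultimately have "step North (cell n (off a) (height a)) \<in> S"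
    using j by (intro link_copy_in[of _ "cell n' (off a') (height a)"]) (auto simp: fwd_def)
  then show False using regularD[OF reg(1)] less(1) b by (cases a) (auto simp: cell_in_S occ_def)
qed

text \<open>Both arms bend at the same distance and hence to the same side. West and central arms,
  which bend to the same side, differ in the length of the bump; two west or two east arms are told
  apart by their heights. Once the kinds agree, copying continues up to the contact cells.\<close>

lemma share:
  assumes reg: "regular n a" "regular n' a'" and m: "1 \<le> m" "1 \<le> m'" "m \<le> b - 4" "m' \<le> b - 4"
    and eq: "\<alpha> (cell n (off a) m) = \<alpha> (cell n' (off a') m')"
  shows "a = a' \<and> m = m' \<and> \<alpha> (contact n a) = \<alpha> (contact n' a')"
proof -
  have align: "bend a - m = bend a' - m'"
    using bend_le[OF reg m eq] bend_le[OF reg(2,1) m(2,1,4,3) eq[symmetric]] by simp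
  define j where "j = nat (bend a - m)"
  have j: "int j = bend a - m" "int j = bend a' - m'"
    using m bend_ge[of a] align by (simp_all add: j_def)
  have tops: "bend a < height a" "bend a' < height a'"
    using bend_less_height regularD(3) reg by blast+
  have bends: "\<alpha> (cell n (off a) (bend a)) = \<alpha> (cell n' (off a') (bend a'))"
  proof -
    have "m + int j = bend a" "m' + int j = bend a'" using j by simp_all
    then show ?thesis using copy_up[OF reg _ _ eq, of j] m tops by simp
  qed
  have fb: "fwd (bdir a) (cell n (off a) (bend a))" "fwd (bdir a') (cell n' (off a') (bend a'))"
    using regular_bend reg by auto
  have side_in: "step (bdir a) (cell n' (off a') (bend a')) \<in> S"
    using fb bends by (intro link_copy_in[of _ "cell n (off a) (bend a)"]) (auto simp: fwd_def)
  have dirs: "bdir a = bdir a'"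
  proof (rule ccontr)
    assume "bdir a \<noteq> bdir a'"
    then have "step (bdir a) (cell n' (off a') (bend a')) \<notin> S"
      using tops bend_ge[of a'] by (intro no_side reg bdir_horizontal) auto
    then show False using side_in by simp
  qed
  define q where "q = step (bdir a) (cell n (off a) (bend a))"
  define q' where "q' = step (bdir a') (cell n' (off a') (bend a'))"
  have not_s: "cell n r y \<noteq> s" "cell n' r y \<noteq> s" if "0 \<le> r" "r < 9" for r y
    using seed_cell[OF regularD(4)[OF reg(1)] that] seed_cell[OF regularD(4)[OF reg(2)] that] by metis+
  have q_not_s: "q \<noteq> s" "q' \<noteq> s"
    unfolding q_def q'_def by (cases a; cases a'; simp add: not_s)+
  have bumps: "\<alpha> q' = \<alpha> q"
    unfolding q_def q'_def dirs
    by (rule link_copy) (use fb bends q_not_s dirs in \<open>auto simp: fwd_def q'_def\<close>)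
  \<comment> \<open>A copy of the first bump cell of a west arm in the bump of a central arm would
    force a second bump cell, which is not in \<open>S\<close>.\<close>
  have C: False if "regular n1 ArmC" "regular n2 (ArmW i)"
    "\<alpha> (cell n1 5 (b - 3)) = \<alpha> (cell n2 2 b)" for n1 n2 i
  proof -
    have "link East (cell n2 2 b)" using regular_bump[OF that(2)] by (simp add: fwd_def)
    then have "cell n1 6 (b - 3) \<in> S" using link_copy_in that(3) by fastforce
    then show False using b by (simp add: cell_in_S occ_def)
  qed
  have aa: "a = a'"
  proof (cases "a = ArmC \<or> a' = ArmC")
    case True
    then show ?thesis
      using C[of n n'] C[of n' n] reg bumps dirs unfolding q_def q'_def by (cases a; cases a') auto
  next
    case False
    then have bb: "bend a = b" "bend a' = b" and mm: "m' = m" using align by (cases a; cases a'; simp)+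
    have "height a = height a'"
      using height_le[OF reg m(1,3) eq[unfolded mm] bb(1)]
        height_le[OF reg(2,1) m(1,3) eq[unfolded mm, symmetric] bb(2)]
      by (cases "height a" "height a'" rule: linorder_cases) blast+
    then show ?thesis using dirs False by (cases a; cases a') auto
  qed
  then have mm: "m = m'" using align by simp
  have "\<alpha> (contact n a) = \<alpha> (contact n' a')"
  proof (cases "a = ArmC")
    case True
    then show ?thesis
      using copy_up[OF reg _ _ eq, of "nat (height a - m)"] m mm aa by simp
  next
    case False
    have con: "contact n1 a = step (bdir a) (step (bdir a) (cell n1 (off a) (bend a)))" for n1
      using False by (cases a) auto
    have "contact n' a \<noteq> s" by (cases a; simp add: not_s)
    then show ?thesis
      using regular_bump[OF reg(1) False] regular_bump[OF reg(2)] False bumps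
      unfolding q_def q'_def aa[symmetric] con
      by - (rule link_copy[symmetric]; auto simp: fwd_def)
  qed
  then show ?thesis using aa mm by simp
qed

text \<open>\<open>fst s div 9\<close> is the gadget whose columns contain the seed. The gadgets
  chosen avoid it and have no site in \<open>S\<close>, so the time condition of regularity is
  vacuous.\<close>

lemma regular_exists: "a \<in> arms \<Longrightarrow> \<exists>n. regular n a"
proof -
  assume "a \<in> arms"
  then consider i where "a = ArmW i" "1 \<le> i" "i \<le> k" | i where "a = ArmE i" "1 \<le> i" "i \<le> k" | "a = ArmC"
    by (auto simp: arms_def)
  then show ?thesis
  proof cases
    case 1
    then show ?thesis using exists_P[of i "fst s div 9"] by (auto simp: regular_def)
  next
    case 2
    then show ?thesis using exists_Q[of i "fst s div 9"] by (auto simp: regular_def)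
  next
    case 3
    then show ?thesis using exists_Q[of 1 "fst s div 9"] k by (auto simp: regular_def)
  qed
qed

lemma cell_type_in_tiles:
  assumes "regular n a" "0 \<le> m" "m \<le> height a"
  obtains t where "\<alpha> (cell n (off a) m) = Some t" "t \<in> tiles \<T>"
proof -
  have "cell n (off a) m \<in> S"
    using regularD[OF assms(1)] assms(2,3) b by (cases a) (auto simp: cell_in_S occ_def)
  then show ?thesis using that in_tiles dom_\<alpha> by blast
qed

text \<open>Choose one regular arm of each of the \<open>2 * k + 1\<close> kinds. An arm whose
  contact differs from that of its representative would be one arm more, and by \<open>share\<close>
  the rows \<open>1\<close> to \<open>b - 4\<close> of all these arms would carry distinct tile
  types.\<close>

lemma contact_unique:
  assumes few: "int (card (tiles \<T>)) < (2 * k + 2) * (b - 4)"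
    and reg: "regular n a" "regular n' a"
  shows "\<alpha> (contact n a) = \<alpha> (contact n' a)"
proof -
  have *: False if reg1: "regular n1 a1" and rep: "\<And>a. a \<in> arms \<Longrightarrow> regular (r a) a"
    and diff: "\<alpha> (contact n1 a1) \<noteq> \<alpha> (contact (r a1) a1)" for n1 a1 r
  proof -
    define I where "I = insert (n1, a1) ((\<lambda>a. (r a, a)) ` arms)"
    let ?F = "\<lambda>((n, a), m). the (\<alpha> (cell n (off a) m))"
    have I: "finite I" "int (card I) = 2 * k + 2"
    proof -
      have "(n1, a1) \<notin> (\<lambda>a. (r a, a)) ` arms" using diff by auto
      then show "finite I" "int (card I) = 2 * k + 2"
        using card_arms finite_arms by (simp_all add: I_def card_image inj_on_def)
    qed
    have regI: "regular n a" if "(n, a) \<in> I" for n a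
      using that reg1 rep by (auto simp: I_def)
    have inj: "inj_on ?F (I \<times> {1..b - 4})"
    proof (rule inj_onI, clarsimp)
      fix n a m n' a' m'
      assume A: "(n, a) \<in> I" "(n', a') \<in> I" "1 \<le> m" "m \<le> b - 4" "1 \<le> m'" "m' \<le> b - 4"
        and eq: "the (\<alpha> (cell n (off a) m)) = the (\<alpha> (cell n' (off a') m'))"
      have "m \<le> height a" "m' \<le> height a'"
        using A bend_ge[of a] bend_ge[of a'] bend_less_height regI[THEN regularD(3)] by force+
      then have "\<alpha> (cell n (off a) m) = \<alpha> (cell n' (off a') m')"
        using eq A cell_type_in_tiles[OF regI[OF A(1)], of m] cell_type_in_tiles[OF regI[OF A(2)], of m']
        by (metis int_one_le_iff_zero_less less_imp_le option.sel)
      then have sh: "a = a'" "m = m'" "\<alpha> (contact n a) = \<alpha> (contact n' a')"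
        using share[OF regI[OF A(1)] regI[OF A(2)]] A by blast+
      then have "n = n'" using A(1,2) diff by (auto simp: I_def)
      then show "n = n' \<and> a = a' \<and> m = m'" using sh by simp
    qed
    have sub: "?F ` (I \<times> {1..b - 4}) \<subseteq> tiles \<T>"
    proof clarsimp
      fix n a m assume A: "(n, a) \<in> I" "1 \<le> m" "m \<le> b - 4"
      have "m \<le> height a"
        using A bend_ge[of a] bend_less_height regI[THEN regularD(3)] by force
      then show "the (\<alpha> (cell n (off a) m)) \<in> tiles \<T>"
        using cell_type_in_tiles[OF regI[OF A(1)], of m] A by (metis int_one_le_iff_zero_less less_imp_le option.sel)
    qed
    have "card (I \<times> {1..b - 4}) \<le> card (tiles \<T>)"
      using card_inj_on_le[OF inj sub finite_tiles] .
    moreover have "int (card (I \<times> {1..b - 4})) = (2 * k + 2) * (b - 4)"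
      using I b by (simp add: card_cartesian_product)
    ultimately show False using few by linarith
  qed
  obtain r where r: "\<And>a. a \<in> arms \<Longrightarrow> regular (r a) a" using regular_exists by metis
  show ?thesis using *[OF reg(1) r] *[OF reg(2) r] by metis
qed

section \<open>Strength inequalities at the sites\<close>

text \<open>Here \<open>u a\<close> stands for the tile type in which the arms of kind \<open>a\<close> touch their sites.\<close>

definition grip :: "(arm \<Rightarrow> tile_type) \<Rightarrow> tile_type \<Rightarrow> arm \<Rightarrow> nat" where
  "grip u t a = (case a of
      ArmW i \<Rightarrow> match_strength (strength \<T>) (west t) (east (u a))
    | ArmE i \<Rightarrow> match_strength (strength \<T>) (east t) (west (u a))
    | ArmC \<Rightarrow> match_strength (strength \<T>) (south t) (north (u a)))"

definition grips :: "(arm \<Rightarrow> tile_type) \<Rightarrow> tile_type \<Rightarrow> int \<Rightarrow> nat" where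
  "grips u t n = (if 0 < w n then grip u t (ArmW (w n)) else 0)
     + (if 0 < e n then grip u t (ArmE (e n)) else 0) + (if c n then grip u t ArmC else 0)"

context
  fixes u :: "arm \<Rightarrow> tile_type"
  assumes u: "\<And>n a. regular n a \<Longrightarrow> \<alpha> (contact n a) = Some (u a)"
begin

text \<open>All arms of such a gadget are regular, so in \<open>\<alpha>\<close> they show the types
  \<open>u a\<close> to the site. A tile gripped strongly enough would attach there, outside
  \<open>S\<close>.\<close>

lemma unfilled_weak:
  assumes n: "0 \<le> n" "n < M" "fst s div 9 \<noteq> n" "\<not> f n" and t: "t \<in> tiles \<T>"
  shows "grips u t n < temperature \<T>"
proof (rule ccontr)
  assume "\<not> grips u t n < temperature \<T>"
  let ?p = "cell n 4 b" and ?g = "strength \<T>"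
  have p: "?p \<notin> S" using n b by (simp add: cell_in_S occ_def)
  have reg: "regular n a" if "has n a" for a using n that by (simp add: regular_def)
  have "(if 0 < w n then grip u t (ArmW (w n)) else 0) \<le> pull ?g \<alpha> t ?p West"
    using u[OF reg[of "ArmW (w n)"]] by (simp add: pull_def grip_def)
  moreover have "(if 0 < e n then grip u t (ArmE (e n)) else 0) \<le> pull ?g \<alpha> t ?p East"
    using u[OF reg[of "ArmE (e n)"]] by (simp add: pull_def grip_def)
  moreover have "(if c n then grip u t ArmC else 0) \<le> pull ?g \<alpha> t ?p South"
    using u[OF reg[of ArmC]] by (simp add: pull_def grip_def)
  ultimately have "grips u t n \<le> attach ?g \<alpha> t ?p"
    unfolding attach_alt grips_def by linarith
  then have "\<alpha> ?p = Some t"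
    using forced[OF producible_\<alpha> _ t, of ?p] p dom_\<alpha> \<open>\<not> grips u t n < temperature \<T>\<close> by simp
  then show False using p dom_\<alpha> by blast
qed

text \<open>The witness is the tile in the site. The neighbours present when it attached are contact
  cells filled earlier; their arms are therefore regular and show the types \<open>u a\<close>.
  Absent neighbours only decrease the left-hand sides.\<close>

lemma filled_strong:
  assumes n: "0 \<le> n" "n < M" "fst s div 9 \<noteq> n" "f n"
  shows "\<exists>t\<in>tiles \<T>. temperature \<T> \<le> grips u t n"
proof -
  let ?p = "cell n 4 b" and ?g = "strength \<T>"
  have p: "?p \<in> S" using n b by (simp add: cell_in_S occ_def)
  have ps: "?p \<noteq> s" using seed_cell[OF n(3), of 4 b] by auto
  obtain t where t: "\<alpha> ?p = Some t" using p dom_\<alpha> by blast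
  let ?\<beta> = "\<alpha> |` {q. tm q < tm ?p}"
  have reg: "?\<beta> (contact n a) = Some (u a) \<or> ?\<beta> (contact n a) = None" if "has n a" for a
  proof (cases "tm (contact n a) < tm ?p")
    case True
    then have "regular n a" using n that by (simp add: regular_def)
    then show ?thesis using u True by simp
  qed simp
  have none: "?\<beta> q = None" if "q \<notin> S" for q using that dom_\<alpha> by (auto simp: restrict_map_def)
  have "pull ?g ?\<beta> t ?p West \<le> (if 0 < w n then grip u t (ArmW (w n)) else 0)"
    using reg[of "ArmW (w n)"] none[of "cell n 3 b"] n b
    by (auto simp: pull_def grip_def cell_in_S occ_def)
  moreover have "pull ?g ?\<beta> t ?p East \<le> (if 0 < e n then grip u t (ArmE (e n)) else 0)"
    using reg[of "ArmE (e n)"] none[of "cell n 5 b"] n b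
    by (auto simp: pull_def grip_def cell_in_S occ_def)
  moreover have "pull ?g ?\<beta> t ?p South \<le> (if c n then grip u t ArmC else 0)"
    using reg[of ArmC] none[of "cell n 4 (b - 1)"] n b
    by (auto simp: pull_def grip_def cell_in_S occ_def)
  moreover have "pull ?g ?\<beta> t ?p North = 0"
    using none[of "cell n 4 (b + 1)"] n b by (simp add: pull_def cell_in_S occ_def)
  moreover have "temperature \<T> \<le> attach ?g ?\<beta> t ?p" using attach_before[OF p ps] t by simp
  ultimately have "temperature \<T> \<le> grips u t n"
    unfolding attach_alt grips_def by linarith
  then show ?thesis using in_tiles[OF t] by blast
qed

lemma strengths_increase:
  "1 \<le> i \<Longrightarrow> int i \<le> k \<Longrightarrow>
    i \<le> strength \<T> (east (u (ArmW (int i)))) \<and> strength \<T> (east (u (ArmW (int i)))) < temperature \<T>"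
proof -
  let ?a = "\<lambda>i. strength \<T> (east (u (ArmW i)))" and ?b = "\<lambda>i. strength \<T> (west (u (ArmE i)))"
  let ?t = "temperature \<T>"
  have gW: "grip u t (ArmW i) = 0 \<or> grip u t (ArmW i) = ?a i"
    and gE: "grip u t (ArmE i) = 0 \<or> grip u t (ArmE i) = ?b i" for t i
    by (auto simp: grip_def match_strength_def)
  have P: "grip u t (ArmW i) + grip u t ArmC < ?t" and Q: "grip u t (ArmE i) + grip u t ArmC < ?t"
    if "1 \<le> i" "i \<le> k" "t \<in> tiles \<T>" for i t
    using exists_P[OF that(1,2), of "fst s div 9"] exists_Q[OF that(1,2), of "fst s div 9"]
      unfilled_weak[OF _ _ _ _ that(3)] that(1) by (force simp: grips_def)+
  have D: "grip u t (ArmW i) + grip u t (ArmE (i + 1)) < ?t"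
    if "1 \<le> i" "i < k" "t \<in> tiles \<T>" for i t
    using exists_D[OF that(1,2), of "fst s div 9"] unfilled_weak[OF _ _ _ _ that(3)] that(1)
    by (force simp: grips_def)
  \<comment> \<open>By \<open>P\<close> and \<open>Q\<close> neither grip suffices alone, so
    \<open>t\<close> matches both glues and the grips equal the glue strengths.\<close>
  have A: "?t \<le> ?a i + ?b i \<and> ?a i < ?t \<and> ?b i < ?t" if i: "1 \<le> i" "i \<le> k" for i
  proof -
    obtain t where t: "t \<in> tiles \<T>" "?t \<le> grip u t (ArmW i) + grip u t (ArmE i)"
      using exists_A[OF i, of "fst s div 9"] filled_strong i(1) by (force simp: grips_def)
    show ?thesis using P[OF i t(1)] Q[OF i t(1)] gW[of t i] gE[of t i] t(2) by linarith
  qed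
  \<comment> \<open>If \<open>t\<close> missed one of the two glues, the other together with the
    central arm would contradict \<open>P\<close> or \<open>Q\<close>. So \<open>t\<close> matches
    both, and \<open>D\<close> bounds the sum of their strengths.\<close>
  have B: "?a i + ?b (i + 1) < ?t" if i: "1 \<le> i" "i < k" for i
  proof -
    obtain t where t: "t \<in> tiles \<T>" "?t \<le> grip u t (ArmW i) + grip u t (ArmE (i + 1)) + grip u t ArmC"
      using exists_B[OF i, of "fst s div 9"] filled_strong i(1) by (force simp: grips_def)
    show ?thesis
      using P[of i t] Q[of "i + 1" t] D[OF i t(1)] gW[of t i] gE[of t "i + 1"] t i by linarith
  qed
  show "1 \<le> i \<Longrightarrow> int i \<le> k \<Longrightarrow> i \<le> ?a (int i) \<and> ?a (int i) < ?t"
  proof (induction i rule: nat_induct_at_least)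
    case base
    then show ?case using A[of 1] by simp
  next
    case (Suc i)
    have "i \<le> ?a (int i)" using Suc by simp
    moreover have "?t \<le> ?a (int i + 1) + ?b (int i + 1) \<and> ?a (int i + 1) < ?t"
      using A[of "int i + 1"] Suc.prems by simp
    moreover have "?a (int i) + ?b (int i + 1) < ?t" using B[of "int i"] Suc.prems Suc.hyps by simp
    moreover have suc: "int (Suc i) = int i + 1" by simp
    ultimately show ?case unfolding suc by linarith
  qed
qed

end

theorem many_tiles:
  assumes "int (temperature \<T>) \<le> k"
  shows "(2 * k + 2) * (b - 4) \<le> int (card (tiles \<T>))"
proof (rule ccontr)
  assume few: "\<not> ?thesis"
  \<comment> \<open>With few tile types the choice of the gadget does not matter, by
    \<open>contact_unique\<close>.\<close>
  define u where "u a = the (\<alpha> (contact (SOME n. regular n a) a))" for a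
  have "\<alpha> (contact n a) = Some (u a)" if reg: "regular n a" for n a
  proof -
    have "contact n a \<in> S" using regularD[OF reg] b by (cases a) (auto simp: cell_in_S occ_def)
    then obtain t where "\<alpha> (contact n a) = Some t" using dom_\<alpha> by blast
    moreover have "regular (SOME n. regular n a) a" using reg by (rule someI)
    from contact_unique[OF _ this reg] few
    have "\<alpha> (contact (SOME n. regular n a) a) = \<alpha> (contact n a)" by linarith
    ultimately show ?thesis by (simp add: u_def)
  qed
  from strengths_increase[OF this, of "nat k"]
  have "k \<le> int (strength \<T> (east (u (ArmW k))))" "strength \<T> (east (u (ArmW k))) < temperature \<T>"
    using k by (simp_all add: nat_le_iff le_nat_iff)
  then show False using assms by linarith
qed

end

section \<open>A small system at the right temperature\<close>

text \<open>\<open>Line\<close> labels name absolute columns, but \<open>Up\<close> and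
  \<open>Bump\<close> labels name only a kind of arm and a position in it, so that equal arms share
  their tiles. The \<open>Tip\<close> labels lie on the edges of the sites.\<close>

datatype label = Nul | Line int | Up arm int | Bump arm int | TipW int | TipE int | TipC

fun arm_code :: "arm \<Rightarrow> nat" where
  "arm_code (ArmW i) = prod_encode (0, int_encode i)"
| "arm_code (ArmE i) = prod_encode (1, int_encode i)"
| "arm_code ArmC = prod_encode (2, 0)"

lemma arm_code_inj [simp]: "arm_code a = arm_code a' \<longleftrightarrow> a = a'"
  by (cases a; cases a') (simp_all add: inj_eq[OF bij_is_inj[OF bij_int_encode]])

fun code :: "label \<Rightarrow> glue" where
  "code Nul = prod_encode (0, 0)"
| "code (Line x) = prod_encode (1, int_encode x)"
| "code (Up a m) = prod_encode (2, prod_encode (arm_code a, int_encode m))"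
| "code (Bump a m) = prod_encode (3, prod_encode (arm_code a, int_encode m))"
| "code (TipW i) = prod_encode (4, int_encode i)"
| "code (TipE i) = prod_encode (5, int_encode i)"
| "code TipC = prod_encode (6, 0)"

lemma code_inj [simp]: "code l = code l' \<longleftrightarrow> l = l'"
  by (cases l; cases l') (simp_all add: inj_eq[OF bij_is_inj[OF bij_int_encode]])

declare code.simps [simp del]

context layout
begin

section \<open>Edge labels of the intended assembly and the parents of cells\<close>

text \<open>\<open>hl\<close> and \<open>vl\<close> label the edges leaving a cell to the east and to the north. The two tiles
  abutting on an edge both carry its label, so the system below has no mismatches.\<close>

definition hl :: "int \<Rightarrow> int \<Rightarrow> int \<Rightarrow> label" where
  "hl n r y = (if n < 0 \<or> M \<le> n then Nul
     else if y = 0 then (if 9 * n + r < 9 * M - 1 then Line (9 * n + r) else Nul)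
     else if 0 < w n \<and> y = b \<and> r = 1 then Bump (ArmW (w n)) 0
     else if 0 < w n \<and> y = b \<and> r = 2 then Bump (ArmW (w n)) 1
     else if 0 < w n \<and> y = b \<and> r = 3 then TipW (w n)
     else if 0 < e n \<and> y = b \<and> r = 4 then TipE (e n)
     else if 0 < e n \<and> y = b \<and> r = 5 then Bump (ArmE (e n)) 1
     else if 0 < e n \<and> y = b \<and> r = 6 then Bump (ArmE (e n)) 0
     else if c n \<and> y = b - 3 \<and> r = 4 then Bump ArmC 0 else Nul)"

definition vl :: "int \<Rightarrow> int \<Rightarrow> int \<Rightarrow> label" where
  "vl n r y = (if n < 0 \<or> M \<le> n \<or> y < 0 then Nul
     else if 0 < w n \<and> r = 1 \<and> y < b + w n then Up (ArmW (w n)) y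
     else if 0 < e n \<and> r = 7 \<and> y < b + e n then Up (ArmE (e n)) y
     else if c n \<and> r = 4 \<and> y < b - 1 then Up ArmC y
     else if c n \<and> r = 4 \<and> y = b - 1 then TipC else Nul)"

fun edge :: "dir \<Rightarrow> pos \<Rightarrow> label" where
  "edge North (x, y) = vl (x div 9) (x mod 9) y"
| "edge South (x, y) = vl (x div 9) (x mod 9) (y - 1)"
| "edge East (x, y) = hl (x div 9) (x mod 9) y"
| "edge West (x, y) = hl ((x - 1) div 9) ((x - 1) mod 9) y"

lemma edge_opp [simp]: "edge (opp d) (step d p) = edge d p"
  by (cases d; cases p) auto

lemma edge_cell:
  assumes "0 \<le> r" "r < 9"
  shows "edge North (cell n r y) = vl n r y" "edge South (cell n r y) = vl n r (y - 1)"
    "edge East (cell n r y) = hl n r y"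
    "edge West (cell n r y) = (if r = 0 then hl (n - 1) 8 y else hl n (r - 1) y)"
proof -
  have 1: "(9 * n + r) div 9 = n" "(9 * n + r) mod 9 = r" using assms by auto
  have "(9 * n + r - 1) div 9 = n \<and> (9 * n + r - 1) mod 9 = r - 1" if "r \<noteq> 0"
  proof -
    have "(9 * n + (r - 1)) div 9 = n" "(9 * n + (r - 1)) mod 9 = r - 1" using assms that by auto
    then show ?thesis by (simp add: algebra_simps)
  qed
  moreover have "(9 * n - 1) div 9 = n - 1 \<and> (9 * n - 1) mod 9 = 8" by presburger
  ultimately show "edge North (cell n r y) = vl n r y" "edge South (cell n r y) = vl n r (y - 1)"
    "edge East (cell n r y) = hl n r y"
    "edge West (cell n r y) = (if r = 0 then hl (n - 1) 8 y else hl n (r - 1) y)"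
    using 1 by (auto simp: cell_def)
qed

text \<open>The direction from the cell that is filled second to the cell that is filled first.\<close>

fun parent_dir :: "label \<Rightarrow> dir option" where
  "parent_dir (Line x) = Some West"
| "parent_dir (Up a m) = Some South"
| "parent_dir (Bump a m) = Some (opp (bdir a))"
| "parent_dir _ = None"

definition bump_cell :: "int \<Rightarrow> arm \<Rightarrow> int \<Rightarrow> pos" where
  "bump_cell n a m = (if m = 0 then step (bdir a) (cell n (off a) (bend a))
     else step (bdir a) (step (bdir a) (cell n (off a) (bend a))))"

lemma vl_cases:
  obtains "vl n r y = Nul"
  | a where "vl n r y = Up a y" "0 \<le> n" "n < M" "has n a" "r = off a" "0 \<le> y" "y < height a"
  | "vl n r y = TipC" "0 \<le> n" "n < M" "c n" "r = 4" "y = b - 1"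
proof -
  have "vl n r y = Nul \<or> (\<exists>a. vl n r y = Up a y \<and> 0 \<le> n \<and> n < M \<and> has n a \<and> r = off a \<and> 0 \<le> y \<and> y < height a)
    \<or> vl n r y = TipC \<and> 0 \<le> n \<and> n < M \<and> c n \<and> r = 4 \<and> y = b - 1"
    unfolding vl_def by auto
  then show ?thesis using that by blast
qed

lemma hl_cases:
  obtains "hl n r y = Nul"
  | "hl n r y = Line (9 * n + r)" "0 \<le> n" "n < M" "9 * n + r < 9 * M - 1" "y = 0"
  | m where "hl n r y = Bump (ArmW (w n)) m" "0 \<le> n" "n < M" "0 < w n" "r = 1 + m" "m = 0 \<or> m = 1" "y = b"
  | m where "hl n r y = Bump (ArmE (e n)) m" "0 \<le> n" "n < M" "0 < e n" "r = 6 - m" "m = 0 \<or> m = 1" "y = b"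
  | "hl n r y = Bump ArmC 0" "0 \<le> n" "n < M" "c n" "r = 4" "y = b - 3"
  | "hl n r y = TipW (w n)" "0 \<le> n" "n < M" "0 < w n" "r = 3" "y = b"
  | "hl n r y = TipE (e n)" "0 \<le> n" "n < M" "0 < e n" "r = 4" "y = b"
proof -
  have "hl n r y = Nul
    \<or> hl n r y = Line (9 * n + r) \<and> 0 \<le> n \<and> n < M \<and> 9 * n + r < 9 * M - 1 \<and> y = 0
    \<or> (\<exists>m. hl n r y = Bump (ArmW (w n)) m \<and> 0 \<le> n \<and> n < M \<and> 0 < w n \<and> r = 1 + m \<and> (m = 0 \<or> m = 1) \<and> y = b)
    \<or> (\<exists>m. hl n r y = Bump (ArmE (e n)) m \<and> 0 \<le> n \<and> n < M \<and> 0 < e n \<and> r = 6 - m \<and> (m = 0 \<or> m = 1) \<and> y = b)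
    \<or> hl n r y = Bump ArmC 0 \<and> 0 \<le> n \<and> n < M \<and> c n \<and> r = 4 \<and> y = b - 3
    \<or> hl n r y = TipW (w n) \<and> 0 \<le> n \<and> n < M \<and> 0 < w n \<and> r = 3 \<and> y = b
    \<or> hl n r y = TipE (e n) \<and> 0 \<le> n \<and> n < M \<and> 0 < e n \<and> r = 4 \<and> y = b"
    unfolding hl_def by auto
  then show ?thesis using that by (elim disjE exE conjE) auto
qed

text \<open>The hypothesis says that the neighbour of \<open>p\<close> in direction \<open>d\<close>
  is its parent. The origin and the sites have no parent.\<close>

lemma parent_cases:
  assumes "parent_dir (edge d p) = Some d"
  obtains x where "p = (x + 1, 0)" "edge d p = Line x" "0 \<le> x" "x < 9 * M - 1"
  | n a m where "p = cell n (off a) (m + 1)" "edge d p = Up a m" "0 \<le> n" "n < M" "has n a" "0 \<le> m" "m < height a"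
  | n a m where "p = bump_cell n a m" "edge d p = Bump a m" "0 \<le> n" "n < M" "has n a"
      "m = 0 \<or> m = 1 \<and> a \<noteq> ArmC"
proof -
  obtain n r y where p: "p = cell n r y" and r: "0 \<le> r" "r < 9" by (rule cell_cases)
  show ?thesis
  proof (cases d)
    case North
    then show ?thesis using assms r by (cases rule: vl_cases[of n r y]) (auto simp: p edge_cell)
  next
    case South
    then show ?thesis using assms r that(2)[of n _ "y - 1"]
      by (cases rule: vl_cases[of n r "y - 1"]) (auto simp: p edge_cell)
  next
    case East
    then have e: "edge d p = hl n r y" using r by (simp add: p edge_cell)
    show ?thesis
    proof (cases rule: hl_cases[of n r y])
      case (4 m)
      then show ?thesis using that(3)[of n "ArmE (e n)" m] e by (auto simp: p bump_cell_def)
    qed (use assms e East in auto)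
  next
    case West
    show ?thesis
    proof (cases "r = 0")
      case True
      then have e: "edge d p = hl (n - 1) 8 y" using West by (simp add: p edge_cell)
      show ?thesis
      proof (cases rule: hl_cases[of "n - 1" 8 y])
        case 2
        then show ?thesis using that(1)[of "9 * n - 1"] e True by (auto simp: p cell_def)
      qed (use assms e West in auto)
    next
      case False
      then have e: "edge d p = hl n (r - 1) y" using r West by (simp add: p edge_cell)
      show ?thesis
      proof (cases rule: hl_cases[of n "r - 1" y])
        case 2
        then show ?thesis using that(1)[of "9 * n + r - 1"] e r False by (auto simp: p cell_def)
      next
        case (3 m)
        then show ?thesis using that(3)[of n "ArmW (w n)" m] e r by (auto simp: p bump_cell_def)
      next
        case 5
        then show ?thesis using that(3)[of n ArmC 0] e r by (auto simp: p bump_cell_def)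
      qed (use assms e West in auto)
    qed
  qed
qed

definition tile_at :: "pos \<Rightarrow> tile_type" where
  "tile_at p = Tile (code (edge North p)) (code (edge West p)) (code (edge South p)) (code (edge East p))"

lemma side_tile_at [simp]: "side d (tile_at p) = code (edge d p)"
  by (cases d) (simp_all add: tile_at_def)

lemma tile_at_cong: "(\<And>d. edge d p = edge d q) \<Longrightarrow> tile_at p = tile_at q"
  by (simp add: tile_at_def)

lemma column_cell_in_S: "0 \<le> n \<Longrightarrow> n < M \<Longrightarrow> has n a \<Longrightarrow> 0 \<le> m \<Longrightarrow> m \<le> height a \<Longrightarrow> cell n (off a) m \<in> S"
  using b by (cases a) (auto simp: cell_in_S occ_def)

lemma bump_cell_in_S: "0 \<le> n \<Longrightarrow> n < M \<Longrightarrow> has n a \<Longrightarrow> m = 0 \<or> m = 1 \<and> a \<noteq> ArmC \<Longrightarrow> bump_cell n a m \<in> S"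
  using b by (cases a) (auto simp: cell_in_S occ_def bump_cell_def)

text \<open>Above row 0 the labels around a column cell do not mention the gadget; in row 0 the
  \<open>Line\<close> labels would.\<close>

lemma column_tile:
  assumes "0 \<le> n" "n < M" "has n a" "0 \<le> n'" "n' < M" "has n' a" "0 \<le> m" "m < height a"
  shows "tile_at (cell n (off a) (m + 1)) = tile_at (cell n' (off a) (m + 1))"
proof (rule tile_at_cong)
  fix d show "edge d (cell n (off a) (m + 1)) = edge d (cell n' (off a) (m + 1))"
    using assms b by (cases a; cases d) (simp_all add: edge_cell vl_def hl_def)
qed

lemma bump_tile:
  assumes "0 \<le> n" "n < M" "has n a" "0 \<le> n'" "n' < M" "has n' a" "m = 0 \<or> m = 1 \<and> a \<noteq> ArmC"
  shows "tile_at (bump_cell n a m) = tile_at (bump_cell n' a m)"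
proof (rule tile_at_cong)
  fix d show "edge d (bump_cell n a m) = edge d (bump_cell n' a m)"
    using assms b unfolding bump_cell_def
    by (elim disjE; cases a; cases d) (simp_all add: edge_cell vl_def hl_def)
qed

lemma parent_in_S: "parent_dir (edge d p) = Some d \<Longrightarrow> p \<in> S"
proof (erule parent_cases)
  fix x assume "p = (x + 1, 0)" "0 \<le> x" "x < 9 * M - 1"
  then show "p \<in> S" by (simp add: S_def)
qed (simp_all add: column_cell_in_S bump_cell_in_S)

text \<open>The label on the edge to the parent determines the whole tile. This makes growth
  deterministic and also bounds the number of tile types.\<close>

lemma parent_tile:
  assumes p: "parent_dir (edge d p) = Some d" and eq: "edge d q = edge d p"
  shows "tile_at q = tile_at p"
proof -
  have q: "parent_dir (edge d q) = Some d" using assms by simp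
  show ?thesis
    using p
  proof (cases rule: parent_cases)
    case (1 x)
    then show ?thesis using q eq by (elim parent_cases) auto
  next
    case (2 n a m)
    from q show ?thesis
      by (cases rule: parent_cases) (use 2 eq in \<open>auto intro!: column_tile\<close>)
  next
    case (3 n a m)
    from q show ?thesis
      by (cases rule: parent_cases) (use 3 eq in \<open>auto intro!: bump_tile\<close>)
  qed
qed

lemma cell_inj:
  assumes "cell n r y = cell n' r' y'" "0 \<le> r" "r < 9" "0 \<le> r'" "r' < 9"
  shows "n = n' \<and> r = r' \<and> y = y'"
proof -
  have eq: "9 * n + r = 9 * n' + r'" "y = y'" using assms(1) by (simp_all add: cell_def)
  have "n = (9 * n + r) div 9" "n' = (9 * n' + r') div 9" using assms by auto
  then have "n = n'" using eq(1) by simp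
  then show ?thesis using eq by simp
qed

lemma line_edge: "0 \<le> x \<Longrightarrow> x < 9 * M - 1 \<Longrightarrow> edge West (x + 1, 0) = Line x"
  by (auto simp: hl_def)

lemma column_edge:
  "0 \<le> n \<Longrightarrow> n < M \<Longrightarrow> has n a \<Longrightarrow> 0 \<le> m \<Longrightarrow> m < height a \<Longrightarrow> edge South (cell n (off a) (m + 1)) = Up a m"
  using b by (cases a) (auto simp: edge_cell vl_def)

lemma bump_edge:
  assumes "0 \<le> n" "n < M" "has n a" "m = 0 \<or> m = 1 \<and> a \<noteq> ArmC"
  shows "edge (opp (bdir a)) (bump_cell n a m) = Bump a m"
  using assms b by (cases a; elim disjE) (auto simp: bump_cell_def edge_cell hl_def)

lemma S_cases:
  assumes "p \<in> S"
  obtains x where "p = (x, 0)" "0 \<le> x" "x < 9 * M"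
  | n a m where "p = cell n (off a) m" "0 \<le> n" "n < M" "has n a" "1 \<le> m" "m \<le> height a"
  | n a m where "p = bump_cell n a m" "0 \<le> n" "n < M" "has n a" "m = 0 \<or> m = 1 \<and> a \<noteq> ArmC"
  | n where "p = cell n 4 b" "0 \<le> n" "n < M" "f n"
proof -
  obtain n r y where p: "p = cell n r y" and r: "0 \<le> r" "r < 9" by (rule cell_cases)
  have n: "0 \<le> n" "n < M" and "y = 0 \<or> occ n r y" using assms r by (auto simp: p cell_in_S)
  then consider "y = 0" | "r = 1" "0 < w n" "1 \<le> y" "y \<le> b + w n" | "r = 2" "0 < w n" "y = b"
    | "r = 3" "0 < w n" "y = b" | "r = 7" "0 < e n" "1 \<le> y" "y \<le> b + e n" | "r = 5" "0 < e n" "y = b"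
    | "r = 6" "0 < e n" "y = b" | "r = 4" "c n" "1 \<le> y" "y < b" | "r = 5" "c n" "y = b - 3"
    | "r = 4" "f n" "y = b"
    unfolding occ_def by metis
  then show ?thesis
  proof cases
    case 1
    then show ?thesis using that(1)[of "9 * n + r"] n r by (simp add: p cell_def)
  next
    case 2
    then show ?thesis using that(2)[of n "ArmW (w n)" y] n by (simp add: p)
  next
    case 3
    then show ?thesis using that(3)[of n "ArmW (w n)" 0] n by (simp add: p bump_cell_def)
  next
    case 4
    then show ?thesis using that(3)[of n "ArmW (w n)" 1] n by (simp add: p bump_cell_def)
  next
    case 5
    then show ?thesis using that(2)[of n "ArmE (e n)" y] n by (simp add: p)
  next
    case 6
    then show ?thesis using that(3)[of n "ArmE (e n)" 1] n by (simp add: p bump_cell_def)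
  next
    case 7
    then show ?thesis using that(3)[of n "ArmE (e n)" 0] n by (simp add: p bump_cell_def)
  next
    case 8
    then show ?thesis using that(2)[of n ArmC y] n by (simp add: p)
  next
    case 9
    then show ?thesis using that(3)[of n ArmC 0] n by (simp add: p bump_cell_def)
  next
    case 10
    then show ?thesis using that(4)[of n] n by (simp add: p)
  qed
qed

lemma contact_cases:
  assumes "has n a"
  shows "(a \<noteq> ArmC \<longrightarrow> contact n a = bump_cell n a 1) \<and> (a = ArmC \<longrightarrow> contact n a = cell n (off a) (height a))"
  by (cases a) (auto simp: bump_cell_def)

text \<open>Induction along the order of growth: base line, columns, bumps, sites. It yields both
  connectedness of \<open>S\<close> and progress of the system.\<close>

lemma S_induct [consumes 1, case_names root parent site]:
  assumes p: "p \<in> S" and root: "Q (0, 0)"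
    and parent: "\<And>p d. p \<in> S \<Longrightarrow> step d p \<in> S \<Longrightarrow> parent_dir (edge d p) = Some d \<Longrightarrow> Q (step d p) \<Longrightarrow> Q p"
    and site: "\<And>n. 0 \<le> n \<Longrightarrow> n < M \<Longrightarrow> f n \<Longrightarrow> (\<And>a. has n a \<Longrightarrow> Q (contact n a)) \<Longrightarrow> Q (cell n 4 b)"
  shows "Q p"
proof -
  have line: "x < 9 * M \<longrightarrow> Q (x, 0)" if "0 \<le> x" for x
    using that
  proof (induction x rule: int_ge_induct)
    case (step x)
    show ?case
    proof
      assume x: "x + 1 < 9 * M"
      show "Q (x + 1, 0)"
        by (rule parent[of _ West]) (use x step line_edge[of x] in \<open>simp_all add: S_def del: edge.simps\<close>)
    qed
  qed (simp add: root)
  have column: "m \<le> height a \<longrightarrow> Q (cell n (off a) m)" if n: "0 \<le> n" "n < M" "has n a" and "0 \<le> m" for n a m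
    using that(4)
  proof (induction m rule: int_ge_induct)
    case base
    have "1 \<le> off a" "off a \<le> 7" by (cases a; simp)+
    then show ?case using n line[of "9 * n + off a"] by (simp add: cell_def)
  next
    case (step m)
    show ?case
    proof
      assume m: "m + 1 \<le> height a"
      show "Q (cell n (off a) (m + 1))"
        by (rule parent[of _ South])
          (use n m step column_edge[OF n, of m] column_cell_in_S[OF n] in simp_all)
    qed
  qed
  have tops: "0 \<le> bend a \<and> bend a \<le> height a" if "has n a" for n a using that b by (cases a) auto
  have bump0: "Q (bump_cell n a 0)" if n: "0 \<le> n" "n < M" "has n a" for n a
  proof (rule parent[of _ "opp (bdir a)"])
    show "step (opp (bdir a)) (bump_cell n a 0) \<in> S"
      using column_cell_in_S[OF n, of "bend a"] tops[OF n(3)] by (simp add: bump_cell_def)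
    show "Q (step (opp (bdir a)) (bump_cell n a 0))"
      using column[OF n, of "bend a"] tops[OF n(3)] by (simp add: bump_cell_def)
  qed (use bump_edge[OF n, of 0] bump_cell_in_S[OF n, of 0] in simp_all)
  have bump1: "Q (bump_cell n a 1)" if n: "0 \<le> n" "n < M" "has n a" and a: "a \<noteq> ArmC" for n a
  proof (rule parent[of _ "opp (bdir a)"])
    have "step (opp (bdir a)) (bump_cell n a 1) = bump_cell n a 0" by (simp add: bump_cell_def)
    then show "step (opp (bdir a)) (bump_cell n a 1) \<in> S" "Q (step (opp (bdir a)) (bump_cell n a 1))"
      using bump_cell_in_S[OF n, of 0] bump0[OF n] by simp_all
  qed (use a bump_edge[OF n, of 1] bump_cell_in_S[OF n, of 1] in simp_all)
  have contacts: "Q (contact n a)" if n: "0 \<le> n" "n < M" "has n a" for n a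
    using contact_cases[OF n(3)] bump1[OF n] column[OF n, of "height a"] b by (cases "a = ArmC") auto
  from p show ?thesis
  proof (cases rule: S_cases)
    case (3 n a m)
    then show ?thesis using bump0[of n a] bump1[of n a] by auto
  next
    case (4 n)
    then show ?thesis using site contacts by simp
  qed (use line column in auto)
qed

lemma shape_S: "shape S"
proof -
  let ?R = "\<lambda>u v. u \<in> S \<and> v \<in> S \<and> adjacent u v"
  have sym: "symp ?R\<^sup>*\<^sup>*"
    by (rule symp_rtranclp) (auto simp: symp_def adjacent_def power2_commute)
  have adj: "adjacent (step d p) p" for d p
    using adjacent_step[of "step d p" p] step_opp(1)[of d p] by metis
  have "?R\<^sup>*\<^sup>* (0, 0) p" if "p \<in> S" for p
    using that
  proof (induction p rule: S_induct)
    case (parent p d)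
    then have "?R (step d p) p" using adj by blast
    then show ?case by (rule rtranclp.rtrancl_into_rtrancl[OF parent(4)])
  next
    case (site n)
    obtain a d where a: "has n a" "cell n 4 b = step d (contact n a)"
    proof -
      \<comment> \<open>Every gadget whose site belongs to the shape has a west arm.\<close>
      have "0 < w n" using gadgets[of n] site by auto
      then show ?thesis using that[of "ArmW (w n)" East] by simp
    qed
    have "contact n a \<in> S"
      using a site b by (cases a) (auto simp: cell_in_S occ_def)
    moreover have "cell n 4 b \<in> S" using site by (simp add: cell_in_S occ_def)
    ultimately have "?R (contact n a) (cell n 4 b)" using a adjacent_step by blast
    then show ?case by (rule rtranclp.rtrancl_into_rtrancl[OF site(4)[OF a(1)]])
  qed simp
  then show ?thesis unfolding shape_def using sympD[OF sym] rtranclp_trans[of ?R] by blast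
qed

section \<open>The system at temperature \<open>k + 1\<close> and its growth\<close>

fun label_strength :: "label \<Rightarrow> nat" where
  "label_strength Nul = 0"
| "label_strength (TipW i) = nat i"
| "label_strength (TipE i) = nat (k + 1 - i)"
| "label_strength TipC = 1"
| "label_strength _ = nat k + 1"

text \<open>Values outside the range of \<open>code\<close> are unspecified, but the tiles of
  \<open>system\<close> carry only codes.\<close>

definition glue_strength :: "glue \<Rightarrow> nat" where
  "glue_strength g = label_strength (inv code g)"

lemma glue_strength_code [simp]: "glue_strength (code l) = label_strength l"
  by (simp add: glue_strength_def inv_f_f inj_def)

definition target :: assembly where
  "target p = (if p \<in> S then Some (tile_at p) else None)"

definition system :: tas where
  "system = \<lparr>tiles = tile_at ` S, seed = [(0, 0) \<mapsto> tile_at (0, 0)],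
     strength = glue_strength, temperature = nat k + 1\<rparr>"

lemma dom_target [simp]: "dom target = S"
  by (auto simp: target_def split: if_splits)

lemma origin_in_S: "(0, 0) \<in> S"
  using M by (simp add: S_def)

lemma pull_tile_at:
  assumes "\<beta> \<subseteq>\<^sub>m target"
  shows "pull glue_strength \<beta> (tile_at q) p d =
     (if step d p \<in> dom \<beta> \<and> edge d q = edge d p then label_strength (edge d p) else 0)"
proof (cases "step d p \<in> dom \<beta>")
  case True
  then have "\<beta> (step d p) = target (step d p)" using assms unfolding map_le_def by blast
  then have "\<beta> (step d p) = Some (tile_at (step d p))" using True by (auto simp: target_def split: if_splits)
  then show ?thesis using True by (simp add: pull_def match_strength_def)
next
  case False
  then show ?thesis by (simp add: pull_def domIff)
qed

text \<open>The invariant of growth: a filled cell has its parent filled. Bonds to a parent are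
  strong in both directions, and this is what prevents a parent from being attached to its
  child.\<close>

definition closed :: "assembly \<Rightarrow> bool" where
  "closed \<beta> \<longleftrightarrow> (\<forall>p\<in>dom \<beta>. \<forall>d. parent_dir (edge d p) = Some d \<longrightarrow> step d p \<in> dom \<beta>)"

lemma parent_dir_axis: "parent_dir (edge d p) = Some d' \<Longrightarrow> d' = d \<or> d' = opp d"
proof -
  obtain x y where p: "p = (x, y)" by (cases p)
  have v: "parent_dir (vl n r z) = Some d' \<Longrightarrow> d' = South" for n r z
    by (cases rule: vl_cases[of n r z]) auto
  have h: "parent_dir (hl n r z) = Some d' \<Longrightarrow> d' = West \<or> d' = East" for n r z
    by (cases rule: hl_cases[of n r z]) auto
  show "parent_dir (edge d p) = Some d' \<Longrightarrow> d' = d \<or> d' = opp d"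
    unfolding p by (cases d) (auto dest: v h)
qed

lemma parent_unique:
  assumes "parent_dir (edge d p) = Some d" "parent_dir (edge d' p) = Some d'"
  shows "d = d'"
proof -
  have horizontal: False
    if "p = cell n (off a) (m + 1)" "p = bump_cell n' a' m'" "m' = 0 \<or> m' = 1 \<and> a' \<noteq> ArmC" for n n' a a' m m'
    using that by (cases a; cases a') (auto simp: bump_cell_def dest!: cell_inj)
  have bump: "bdir a = bdir a'"
    if "p = bump_cell n a m" "p = bump_cell n' a' m'" "m = 0 \<or> m = 1 \<and> a \<noteq> ArmC" "m' = 0 \<or> m' = 1 \<and> a' \<noteq> ArmC"
    for n n' a a' m m'
    using that by (cases a; cases a') (auto simp: bump_cell_def dest!: cell_inj)
  have base: "snd (bump_cell n a m) \<noteq> 0" for n a m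
    using b by (cases a) (auto simp: bump_cell_def cell_def)
  note pd = assms
  from assms(1) show ?thesis
  proof (cases rule: parent_cases)
    case p: (1 x)
    from assms(2) show ?thesis
    proof (cases rule: parent_cases)
      case (1 x')
      then show ?thesis using p pd by (metis option.inject parent_dir.simps(1))
    next
      case (2 n a m)
      then show ?thesis using p by (simp add: cell_def)
    next
      case (3 n a m)
      then show ?thesis using base[of n a m] p by (metis snd_conv)
    qed
  next
    case p: (2 n a m)
    from assms(2) show ?thesis
    proof (cases rule: parent_cases)
      case (1 x)
      then show ?thesis using p by (simp add: cell_def)
    next
      case (2 n' a' m')
      then show ?thesis using p pd by (metis option.inject parent_dir.simps(2))
    next
      case (3 n' a' m')
      then show ?thesis using horizontal p by blast
    qed
  next
    case p: (3 n a m)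
    from assms(2) show ?thesis
    proof (cases rule: parent_cases)
      case (1 x)
      then show ?thesis using base[of n a m] p by (metis snd_conv)
    next
      case (2 n' a' m')
      then show ?thesis using horizontal p by blast
    next
      case (3 n' a' m')
      have "bdir a = bdir a'" using bump 3(1,6) p(1,6) by blast
      then show ?thesis using 3(2) p(2) pd by (metis option.inject parent_dir.simps(3))
    qed
  qed
qed

lemma tip_cases:
  assumes "parent_dir (edge d p) = None" "edge d p \<noteq> Nul"
  obtains n where "0 \<le> n" "n < M" "edge d p = TipW (w n)" "0 < w n"
      "p = cell n 4 b \<and> d = West \<or> p = cell n 3 b \<and> d = East"
  | n where "0 \<le> n" "n < M" "edge d p = TipE (e n)" "0 < e n"
      "p = cell n 4 b \<and> d = East \<or> p = cell n 5 b \<and> d = West"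
  | n where "0 \<le> n" "n < M" "edge d p = TipC" "c n"
      "p = cell n 4 b \<and> d = South \<or> p = cell n 4 (b - 1) \<and> d = North"
proof -
  obtain n r y where p: "p = cell n r y" and r: "0 \<le> r" "r < 9" by (rule cell_cases)
  show ?thesis
  proof (cases d)
    case North
    then have e: "edge d p = vl n r y" using r by (simp add: p edge_cell)
    show ?thesis
      by (cases rule: vl_cases[of n r y]) (use assms e North that(3)[of n] in \<open>auto simp: p\<close>)
  next
    case South
    then have e: "edge d p = vl n r (y - 1)" using r by (simp add: p edge_cell)
    show ?thesis
      by (cases rule: vl_cases[of n r "y - 1"]) (use assms e South that(3)[of n] in \<open>auto simp: p\<close>)
  next
    case East
    then have e: "edge d p = hl n r y" using r by (simp add: p edge_cell)
    show ?thesis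
      by (cases rule: hl_cases[of n r y])
        (use assms e East that(1,2)[of n] in \<open>auto simp: p\<close>)
  next
    case West
    show ?thesis
    proof (cases "r = 0")
      case True
      then have e: "edge d p = hl (n - 1) 8 y" using West by (simp add: p edge_cell)
      show ?thesis by (cases rule: hl_cases[of "n - 1" 8 y]) (use assms e in auto)
    next
      case False
      then have e: "edge d p = hl n (r - 1) y" using West r by (simp add: p edge_cell)
      show ?thesis
      proof (cases rule: hl_cases[of n "r - 1" y])
        case 6
        then have "r = 4" by simp
        then show ?thesis using 6 e West that(1)[of n] by (simp add: p)
      next
        case 7
        then have "r = 5" by simp
        then show ?thesis using 7 e West that(2)[of n] by (simp add: p)
      qed (use assms e in auto)
    qed
  qed
qed

lemma tip_strength:
  assumes "parent_dir (edge d p) = None"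
  shows "label_strength (edge d p) \<le> nat k"
proof (cases "edge d p = Nul")
  case False
  from tip_cases[OF assms this] show ?thesis
    by cases (use indices k in \<open>auto intro!: nat_mono\<close>)
qed simp

text \<open>Together with \<open>tip_strength\<close> this shows that tip glues alone can fill
  nothing but sites: elsewhere at most one of them acts, with strength at most
  \<open>k\<close>.\<close>

lemma tip_unique:
  assumes d: "parent_dir (edge d p) = None" "edge d p \<noteq> Nul"
    and d': "parent_dir (edge d' p) = None" "edge d' p \<noteq> Nul"
    and p: "\<And>n. p \<noteq> cell n 4 b"
  shows "d = d'"
  using d
proof (cases rule: tip_cases)
  case (1 n)
  from d' show ?thesis
    by (cases rule: tip_cases) (use 1 p in \<open>auto dest!: cell_inj simp del: edge.simps\<close>)
next
  case (2 n)
  from d' show ?thesis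
    by (cases rule: tip_cases) (use 2 p in \<open>auto dest!: cell_inj simp del: edge.simps\<close>)
next
  case (3 n)
  from d' show ?thesis
    by (cases rule: tip_cases) (use 3 p in \<open>auto dest!: cell_inj simp del: edge.simps\<close>)
qed

lemma site_edges:
  assumes "0 \<le> n" "n < M"
  shows "edge North (cell n 4 b) = Nul" "edge South (cell n 4 b) = (if c n then TipC else Nul)"
    "edge West (cell n 4 b) = (if 0 < w n then TipW (w n) else Nul)"
    "edge East (cell n 4 b) = (if 0 < e n then TipE (e n) else Nul)"
  using assms b by (auto simp: edge_cell vl_def hl_def)

lemma site_parentless: "parent_dir (edge d (cell n 4 b)) = None"
  using b by (cases d) (auto simp: edge_cell vl_def hl_def)

text \<open>With total strength at least \<open>k + 1\<close>, the glues of gadget \<open>n\<close>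
  must match the site tile of a gadget \<open>n'\<close> on the west and east sides, and on the
  south side too if the indices differ. Then \<open>n\<close> and \<open>n'\<close> are of the same
  sort.\<close>

lemma attach_site:
  assumes \<beta>: "\<beta> \<subseteq>\<^sub>m target" and q: "q \<in> S"
    and att: "nat k + 1 \<le> attach glue_strength \<beta> (tile_at q) (cell n 4 b)"
  shows "cell n 4 b \<in> S \<and> tile_at q = tile_at (cell n 4 b)"
proof -
  let ?p = "cell n 4 b"
  let ?P = "\<lambda>d. pull glue_strength \<beta> (tile_at q) ?p d"
  have n: "0 \<le> n" "n < M"
  proof -
    have "edge d ?p = Nul" if "\<not> (0 \<le> n \<and> n < M)" for d
      using that by (cases d) (auto simp: edge_cell vl_def hl_def)
    then have "\<not> (0 \<le> n \<and> n < M) \<Longrightarrow> attach glue_strength \<beta> (tile_at q) ?p = 0"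
      by (simp add: attach_alt pull_tile_at[OF \<beta>])
    then show "0 \<le> n" "n < M" using att by fastforce+
  qed
  note se = site_edges[OF n]
  define A where "A \<longleftrightarrow> 0 < w n \<and> edge West q = TipW (w n)"
  define B where "B \<longleftrightarrow> 0 < e n \<and> edge East q = TipE (e n)"
  define C where "C \<longleftrightarrow> c n \<and> edge South q = TipC"
  have "?P West \<le> (if A then nat (w n) else 0)" "?P East \<le> (if B then nat (k + 1 - e n) else 0)"
    "?P South \<le> (if C then 1 else 0)" "?P North = 0"
    by (auto simp: pull_tile_at[OF \<beta>] se A_def B_def C_def)
  then have "nat k + 1 \<le> (if A then nat (w n) else 0) + (if B then nat (k + 1 - e n) else 0) + (if C then 1 else 0)"
    using att unfolding attach_alt by linarith
  then have sum: "k + 1 \<le> (if A then w n else 0) + (if B then k + 1 - e n else 0) + (if C then 1 else 0)"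
    using k indices[OF n] by (auto split: if_splits)
  \<comment> \<open>The central arm alone contributes 1, which is less than
    \<open>k + 1\<close>.\<close>
  then have "A \<or> B" using k by (auto split: if_splits)
  then obtain n' where n': "0 \<le> n'" "n' < M" "q = cell n' 4 b"
  proof
    assume A
    then have "parent_dir (edge West q) = None" "edge West q \<noteq> Nul" "edge West q = TipW (w n)"
      by (simp_all add: A_def)
    then show ?thesis by (cases rule: tip_cases) (use that in auto)
  next
    assume B
    then have "parent_dir (edge East q) = None" "edge East q \<noteq> Nul" "edge East q = TipE (e n)"
      by (simp_all add: B_def)
    then show ?thesis by (cases rule: tip_cases) (use that in auto)
  qed
  have "f n'" using q n' b by (simp add: cell_in_S occ_def)
  then obtain i where i: "1 \<le> i" "w n' = i" "i \<le> k" "e n' = i \<and> \<not> c n' \<or> i < k \<and> e n' = i + 1 \<and> c n'"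
    using gadgets[OF n'(1,2)] by force
  note se' = site_edges[OF n'(1,2), folded n'(3)]
  have ABC: "A \<longleftrightarrow> w n = i" "B \<longleftrightarrow> e n = e n'" "C \<longleftrightarrow> c n \<and> c n'"
    using i by (auto simp: A_def B_def C_def se')
  \<comment> \<open>The sum reaches \<open>k + 1\<close> only as \<open>i + (k + 1 - i)\<close> or
    as \<open>i + (k - i) + 1\<close>. A gadget with one side arm falls short: the central bond
    counts only if \<open>c n'\<close>, and then \<open>i < k\<close>.\<close>
  have "w n = w n' \<and> e n = e n' \<and> c n = c n' \<and> f n"
    using gadgets[OF n] sum i unfolding ABC by (elim disjE exE conjE) (auto split: if_splits)
  then show ?thesis
    using n by (simp add: cell_in_S occ_def tile_at_def se se')
qed

text \<open>If an edge with a parent direction contributes, \<open>p\<close> is attached to its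
  parent and \<open>parent_tile\<close> determines the tile. Otherwise only tips contribute, so
  \<open>p\<close> is a site and \<open>attach_site\<close> applies.\<close>

lemma attach_unique:
  assumes cl: "closed \<beta>" and \<beta>: "\<beta> \<subseteq>\<^sub>m target" and p: "p \<notin> dom \<beta>" and q: "q \<in> S"
    and att: "nat k + 1 \<le> attach glue_strength \<beta> (tile_at q) p"
  shows "target p = Some (tile_at q) \<and> closed (\<beta>(p \<mapsto> tile_at q))"
proof -
  let ?P = "pull glue_strength \<beta> (tile_at q) p"
  show ?thesis
  proof (cases "\<exists>d. ?P d \<noteq> 0 \<and> parent_dir (edge d p) \<noteq> None")
    case True
    then obtain d d' where d: "?P d \<noteq> 0" "parent_dir (edge d p) = Some d'" by blast
    then have nb: "step d p \<in> dom \<beta>" "edge d q = edge d p"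
      by (auto simp: pull_tile_at[OF \<beta>] split: if_splits)
    \<comment> \<open>Otherwise \<open>p\<close> would be the parent of a filled cell and, as
      \<open>\<beta>\<close> is closed, filled itself.\<close>
    have "d' \<noteq> opp d"
    proof
      assume "d' = opp d"
      then have "parent_dir (edge (opp d) (step d p)) = Some (opp d)" using d(2) by simp
      then have "step (opp d) (step d p) \<in> dom \<beta>" using cl nb(1) unfolding closed_def by blast
      then show False using p by simp
    qed
    then have par: "parent_dir (edge d p) = Some d" using parent_dir_axis[OF d(2)] d(2) by auto
    have "tile_at q = tile_at p" by (rule parent_tile[OF par nb(2)])
    moreover have "closed (\<beta>(p \<mapsto> tile_at q))"
      unfolding closed_def
    proof (intro ballI allI impI)
      fix u e assume u: "u \<in> dom (\<beta>(p \<mapsto> tile_at q))" "parent_dir (edge e u) = Some e"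
      show "step e u \<in> dom (\<beta>(p \<mapsto> tile_at q))"
      proof (cases "u = p")
        case True
        then have "e = d" using parent_unique[OF u(2)] par by simp
        then show ?thesis using True nb(1) by simp
      next
        case False
        then have "u \<in> dom \<beta>" using u(1) by simp
        then show ?thesis using u(2) cl unfolding closed_def by simp
      qed
    qed
    ultimately show ?thesis using parent_in_S[OF par] by (simp add: target_def)
  next
    case False
    have tip: "parent_dir (edge d p) = None \<and> edge d p \<noteq> Nul" if "?P d \<noteq> 0" for d
      using that False by (auto simp: pull_tile_at[OF \<beta>] split: if_splits)
    have "\<exists>n. p = cell n 4 b"
    proof (rule ccontr)
      assume ns: "\<nexists>n. p = cell n 4 b"
      have "attach glue_strength \<beta> (tile_at q) p \<noteq> 0" using att by simp
      then obtain d where d: "?P d \<noteq> 0" unfolding attach_def by (meson sum.neutral)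
      have "?P d' = 0" if "d' \<noteq> d" for d'
      proof (rule ccontr)
        assume "?P d' \<noteq> 0"
        from tip[OF this] tip[OF d] have "d = d'"
          by (intro tip_unique[of d p d']) (use ns in auto)
        then show False using that by simp
      qed
      then have "attach glue_strength \<beta> (tile_at q) p = (\<Sum>d'\<in>{d}. ?P d')"
        unfolding attach_def by (intro sum.mono_neutral_right) auto
      also have "\<dots> \<le> nat k"
        using tip_strength[of d p] tip[OF d] by (simp add: pull_tile_at[OF \<beta>])
      finally show False using att by simp
    qed
    then obtain n where n: "p = cell n 4 b" ..
    have "p \<in> S \<and> tile_at q = tile_at p" using attach_site[OF \<beta> q] att n by simp
    moreover have "closed (\<beta>(p \<mapsto> tile_at q))"
      using cl site_parentless[of _ n] unfolding closed_def n by auto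
    ultimately show ?thesis by (simp add: target_def)
  qed
qed

text \<open>If nothing could attach, \<open>S_induct\<close> would show all of \<open>S\<close> to
  be filled. At a site the available strengths are \<open>i + (k + 1 - i)\<close> or
  \<open>i + (k - i) + 1\<close>.\<close>

lemma attach_progress:
  assumes \<beta>: "\<beta> \<subseteq>\<^sub>m target" and origin: "(0, 0) \<in> dom \<beta>" and ne: "dom \<beta> \<noteq> S"
  shows "\<exists>p t. p \<notin> dom \<beta> \<and> target p = Some t \<and> nat k + 1 \<le> attach glue_strength \<beta> t p"
proof (rule ccontr)
  assume neg: "\<not> ?thesis"
  have full: "p \<in> dom \<beta>" if "p \<in> S" "nat k + 1 \<le> attach glue_strength \<beta> (tile_at p) p" for p
    using neg that unfolding target_def by metis
  have "p \<in> dom \<beta>" if "p \<in> S" for p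
    using that
  proof (induction p rule: S_induct)
    case (parent p d)
    have "label_strength (edge d p) = nat k + 1"
      using parent(3) by (cases "edge d p") auto
    then show ?case
      using full[OF parent(1)] pull_le_attach[of glue_strength \<beta> "tile_at p" p d] parent(4)
      by (simp add: pull_tile_at[OF \<beta>])
  next
    case (site n)
    let ?P = "pull glue_strength \<beta> (tile_at (cell n 4 b)) (cell n 4 b)"
    note se = site_edges[OF site(1,2)]
    from gadgets[OF site(1,2)] site(3) obtain i where i: "1 \<le> i" "i \<le> k" "w n = i"
      "e n = i \<or> e n = i + 1 \<and> c n"
      by force
    have "cell n 3 b \<in> dom \<beta>" "cell n 5 b \<in> dom \<beta>" "c n \<Longrightarrow> cell n 4 (b - 1) \<in> dom \<beta>"
      using site(4)[of "ArmW (w n)"] site(4)[of "ArmE (e n)"] site(4)[of ArmC] i by auto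
    then have "?P West = nat i" "?P East = nat (k + 1 - e n)" "c n \<Longrightarrow> ?P South = 1"
      using i by (auto simp: pull_tile_at[OF \<beta>] se)
    then have "nat k + 1 \<le> attach glue_strength \<beta> (tile_at (cell n 4 b)) (cell n 4 b)"
      using i unfolding attach_alt by (elim disjE) auto
    moreover have "cell n 4 b \<in> S" using site by (simp add: cell_in_S occ_def)
    ultimately show ?case using full by blast
  qed (rule origin)
  moreover have "dom \<beta> \<subseteq> S" using map_le_implies_dom_le[OF \<beta>] by simp
  ultimately show False using ne by blast
qed

lemma is_tas_system: "is_tas system"
  using finite_S origin_in_S by (auto simp: is_tas_def system_def)

lemma system_assembles: "directed system \<and> strictly_self_assembles system S"
proof -
  have "directed system \<and> strictly_self_assembles system (dom target)"
  proof (rule directed_self_assemblyI[where I = closed and ?p0.0 = "(0, 0)" and ?t0.0 = "tile_at (0, 0)"])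
    show "closed (seed system)"
      unfolding closed_def
    proof (intro ballI allI impI)
      fix p d assume p: "p \<in> dom (seed system)" and d: "parent_dir (edge d p) = Some d"
      have "p = (0, 0)" using p by (auto simp: system_def split: if_splits)
      moreover have "snd (bump_cell n a m) \<noteq> 0" for n a m
        using b by (cases a) (auto simp: bump_cell_def cell_def)
      then have "bump_cell n a m \<noteq> (0, 0)" for n a m by (metis snd_conv)
      ultimately show "step d p \<in> dom (seed system)"
        using d by (elim parent_cases) (auto simp: cell_def)
    qed
  next
    fix \<beta> p t
    assume "closed \<beta>" "\<beta> \<subseteq>\<^sub>m target" "p \<notin> dom \<beta>" "t \<in> tiles system"
      "temperature system \<le> attach (strength system) \<beta> t p"
    then show "target p = Some t \<and> closed (\<beta>(p \<mapsto> t))"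
      using attach_unique[of \<beta> p] by (auto simp: system_def)
  next
    fix \<beta> assume "\<beta> \<subseteq>\<^sub>m target" "(0, 0) \<in> dom \<beta>" "dom \<beta> \<noteq> dom target"
    then show "\<exists>p t. p \<notin> dom \<beta> \<and> target p = Some t \<and> temperature system \<le> attach (strength system) \<beta> t p"
      using attach_progress by (simp add: system_def)
  next
    show "ran target \<subseteq> tiles system" by (auto simp: ran_def target_def system_def split: if_splits)
  qed (use is_tas_system origin_in_S finite_S in \<open>simp_all add: system_def target_def\<close>)
  then show ?thesis by simp
qed

section \<open>The number of tile types of the system\<close>

definition labels :: "label set" where
  "labels = Line ` {0..<9 * M} \<union> (\<lambda>(a, m). Up a m) ` (arms \<times> {0..<b + k}) \<union> (\<lambda>(a, m). Bump a m) ` (arms \<times> {0, 1})"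

lemma finite_labels: "finite labels"
  by (simp add: labels_def finite_arms)

lemma card_labels: "int (card labels) \<le> 9 * M + (2 * k + 1) * (b + k) + (2 * k + 1) * 2"
proof -
  have "card labels \<le> card (Line ` {0..<9 * M}) + card ((\<lambda>(a, m). Up a m) ` (arms \<times> {0..<b + k}))
      + card ((\<lambda>(a, m). Bump a m) ` (arms \<times> {0 :: int, 1}))"
    unfolding labels_def by (meson add_mono card_Un_le le_refl order_trans)
  also have "\<dots> \<le> card {0..<9 * M} + card (arms \<times> {0..<b + k}) + card (arms \<times> {0 :: int, 1})"
    by (intro add_mono card_image_le) (simp_all add: finite_arms)
  finally have "int (card labels) \<le> int (card {0..<9 * M} + card (arms \<times> {0..<b + k}) + card (arms \<times> {0 :: int, 1}))"
    by (simp only: of_nat_le_iff)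
  also have "\<dots> = 9 * M + (2 * k + 1) * (b + k) + (2 * k + 1) * 2"
    using card_arms M b k by (simp add: card_cartesian_product)
  finally show ?thesis .
qed

text \<open>Apart from the origin and the sites, every cell has a parent, and by
  \<open>parent_tile\<close> its tile is a function of the label on the edge to that parent.\<close>

lemma tiles_system:
  "tiles system \<subseteq> insert (tile_at (0, 0))
     ((\<lambda>l. tile_at (SOME p. edge (the (parent_dir l)) p = l)) ` labels \<union> (\<lambda>n. tile_at (cell n 4 b)) ` {0..<M})"
  (is "_ \<subseteq> insert _ (?F ` labels \<union> ?G)")
proof -
  have labelled: "tile_at p \<in> ?F ` labels" if p: "edge d p \<in> labels" "parent_dir (edge d p) = Some d" for p d
  proof -
    let ?q = "SOME q. edge (the (parent_dir (edge d p))) q = edge d p"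
    have "edge (the (parent_dir (edge d p))) ?q = edge d p" by (rule someI[of _ p]) (simp add: p)
    then have "edge d ?q = edge d p" by (simp add: p)
    then have "tile_at p = ?F (edge d p)" using parent_tile[OF p(2)] by metis
    then show ?thesis using p(1) by blast
  qed
  have in_arms: "a \<in> arms \<and> height a \<le> b + k" if "has n a" "0 \<le> n" "n < M" for n a
    using that indices[of n] b k by (cases a) (auto simp: arms_def)
  have "tile_at p \<in> insert (tile_at (0, 0)) (?F ` labels \<union> ?G)" if "p \<in> S" for p
    using that
  proof (cases rule: S_cases)
    case (1 x)
    show ?thesis
    proof (cases "x = 0")
      case False
      then have "edge West p = Line (x - 1)" using 1 line_edge[of "x - 1"] by simp
      then show ?thesis using labelled[of West p] 1 False by (simp add: labels_def)
    qed (use 1 in simp)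
  next
    case (2 n a m)
    then have "edge South p = Up a (m - 1)" using column_edge[of n a "m - 1"] by simp
    moreover have "Up a (m - 1) \<in> labels" using in_arms[of n a] 2 by (auto simp: labels_def)
    ultimately show ?thesis using labelled[of South p] by simp
  next
    case (3 n a m)
    then have "edge (opp (bdir a)) p = Bump a m" using bump_edge[of n a m] by simp
    moreover have "Bump a m \<in> labels" using in_arms[of n a] 3 by (auto simp: labels_def)
    ultimately show ?thesis using labelled[of "opp (bdir a)" p] by simp
  qed auto
  then show ?thesis by (auto simp: system_def)
qed

lemma card_system: "int (card (tiles system)) \<le> 1 + 10 * M + (2 * k + 1) * (b + k + 2)"
proof -
  let ?F = "\<lambda>l. tile_at (SOME p. edge (the (parent_dir l)) p = l)" and ?G = "\<lambda>n. tile_at (cell n 4 b)"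
  have "card (tiles system) \<le> card (insert (tile_at (0, 0)) (?F ` labels \<union> ?G ` {0..<M}))"
    using finite_labels by (intro card_mono tiles_system) auto
  also have "\<dots> \<le> Suc (card (?F ` labels \<union> ?G ` {0..<M}))"
    by (rule card_insert_le_m1) simp_all
  also have "\<dots> \<le> Suc (card (?F ` labels) + card (?G ` {0..<M}))"
    by (simp add: card_Un_le)
  also have "\<dots> \<le> Suc (card labels + card {0..<M})"
    unfolding Suc_le_mono using finite_labels by (intro add_mono card_image_le) simp_all
  finally have "int (card (tiles system)) \<le> 1 + int (card labels) + M" using M by simp
  then show ?thesis using card_labels by (simp add: algebra_simps)
qed

end

section \<open>Comparison\<close>

text \<open>The gadgets are fixed before the row \<open>b\<close>, which may therefore be made large
  compared to \<open>M\<close>.\<close>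

lemma layout_exists:
  fixes k :: int
  assumes k: "1 \<le> k"
  shows "\<exists>M w e c f. \<forall>b\<ge>5. layout k b M w e c f"
proof -
  define K :: "(int \<times> int \<times> bool \<times> bool) set" where
    "K = (\<lambda>i. (i, i, False, True)) ` {1..k} \<union> (\<lambda>i. (i, 0, True, False)) ` {1..k}
      \<union> (\<lambda>i. (0, i, True, False)) ` {1..k} \<union> (\<lambda>i. (i, i + 1, True, True)) ` {1..<k}
      \<union> (\<lambda>i. (i, i + 1, False, False)) ` {1..<k}"
  have "finite K" by (simp add: K_def)
  then obtain xs where xs: "set xs = K" using finite_list by blast
  define M where "M = int (length (xs @ xs))"
  define g where "g n = (xs @ xs) ! nat n" for n :: int
  have "(1, 1, False, True) \<in> K" using k by (auto simp: K_def)
  then have M: "0 < M" using xs by (auto simp: M_def)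
  have g: "g n \<in> K" if "0 \<le> n" "n < M" for n
  proof -
    have "nat n < length (xs @ xs)" using that by (auto simp: M_def)
    then have "g n \<in> set (xs @ xs)" unfolding g_def by (rule nth_mem)
    then show ?thesis using xs by simp
  qed
  have twice: "\<exists>n. 0 \<le> n \<and> n < M \<and> n \<noteq> n0 \<and> g n = x" if x: "x \<in> K" for x n0
  proof -
    obtain j where j: "j < length xs" "xs ! j = x" 
      using x unfolding xs[symmetric] in_set_conv_nth by blast
    have *: "g (int j) = x" "g (int (j + length xs)) = x" 
      using j by (simp_all only: g_def nth_append nat_int) simp_all
    have "int j < M" "int (j + length xs) < M" using j by (simp_all add: M_def)
    moreover have "int j \<noteq> n0 \<or> int (j + length xs) \<noteq> n0" using j by auto
    moreover have "0 \<le> int j" "0 \<le> int (j + length xs)" by simp_all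
    ultimately show ?thesis using * by blast
  qed
  define w where "w n = fst (g n)" for n
  define e where "e n = fst (snd (g n))" for n
  define c where "c n = fst (snd (snd (g n)))" for n
  define f where "f n = snd (snd (snd (g n)))" for n
  have g_eq: "g n = (w n, e n, c n, f n)" for n by (simp add: w_def e_def c_def f_def)
  have "layout k b M w e c f" if b: "5 \<le> b" for b
  proof
    fix n assume "0 \<le> n" "n < M"
    from g[OF this] show "(\<exists>i. 1 \<le> i \<and> i \<le> k \<and> (w n = i \<and> e n = i \<and> \<not> c n \<and> f n
        \<or> w n = i \<and> e n = 0 \<and> c n \<and> \<not> f n \<or> w n = 0 \<and> e n = i \<and> c n \<and> \<not> f n))
      \<or> (\<exists>i. 1 \<le> i \<and> i < k \<and> w n = i \<and> e n = i + 1 \<and> (c n \<longleftrightarrow> f n))"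
      unfolding K_def g_eq by (elim UnE imageE) simp_all
  next
    fix i n0 assume "1 \<le> i" "i \<le> k"
    then have "(i, i, False, True) \<in> K" "(i, 0, True, False) \<in> K" "(0, i, True, False) \<in> K"
      by (simp_all add: K_def)
    from this[THEN twice, of n0]
    show "\<exists>n\<ge>0. n < M \<and> n \<noteq> n0 \<and> w n = i \<and> e n = i \<and> \<not> c n \<and> f n"
      "\<exists>n\<ge>0. n < M \<and> n \<noteq> n0 \<and> w n = i \<and> e n = 0 \<and> c n \<and> \<not> f n"
      "\<exists>n\<ge>0. n < M \<and> n \<noteq> n0 \<and> w n = 0 \<and> e n = i \<and> c n \<and> \<not> f n"
      unfolding g_eq by simp_all
  next
    fix i n0 assume "1 \<le> i" "i < k"
    then have "(i, i + 1, True, True) \<in> K" "(i, i + 1, False, False) \<in> K"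
      by (simp_all add: K_def)
    from this[THEN twice, of n0]
    show "\<exists>n\<ge>0. n < M \<and> n \<noteq> n0 \<and> w n = i \<and> e n = i + 1 \<and> c n \<and> f n"
      "\<exists>n\<ge>0. n < M \<and> n \<noteq> n0 \<and> w n = i \<and> e n = i + 1 \<and> \<not> c n \<and> \<not> f n"
      unfolding g_eq by simp_all
  qed (fact k, fact b, fact M)
  then show ?thesis by blast
qed

theorem theorem3:
  fixes \<tau> :: nat
  assumes "2 \<le> \<tau>"
  shows "\<exists>S. shape S \<and> finite S \<and> (\<forall>\<tau>'. 1 \<le> \<tau>' \<and> \<tau>' \<le> \<tau> - 1 \<longrightarrow> dtc \<tau> S < dtc \<tau>' S)"
proof -
  define k where "k = int \<tau> - 1"
  have k: "1 \<le> k" using assms by (simp add: k_def)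
  obtain M w e c f where L: "\<And>b. 5 \<le> b \<Longrightarrow> layout k b M w e c f" using layout_exists[OF k] by blast
  have M: "0 < M" using L[of 5] by (simp add: layout_def)
  \<comment> \<open>The lower bound \<open>(2 * k + 2) * (b - 4)\<close> has one more multiple of
    \<open>b\<close> than the bound in \<open>card_system\<close>. This choice makes it exceed the
    latter by 11.\<close>
  define b where "b = 10 * M + (2 * k + 1) * (k + 2) + 8 * k + 20"
  have "0 \<le> (2 * k + 1) * (k + 2)" using k by simp
  then have b: "5 \<le> b" using M k by (simp add: b_def)
  interpret layout k b M w e c f by (rule L[OF b])
  let ?N = "(2 * k + 2) * (b - 4)"
  have "int (card (tiles system)) < ?N"
    using card_system k M by (simp add: b_def algebra_simps)
  then have less: "enat (card (tiles system)) < enat (nat ?N)" by simp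
  have "nat k + 1 = \<tau>" using assms by (simp add: k_def)
  then have temp: "temperature system = \<tau>" by (simp add: system_def)
  have upper: "dtc \<tau> S \<le> enat (card (tiles system))"
    unfolding dtc_def by (rule INF_lower) (simp add: is_tas_system system_assembles temp)
  have lower: "enat (nat ?N) \<le> dtc \<tau>' S" if \<tau>': "1 \<le> \<tau>'" "\<tau>' \<le> \<tau> - 1" for \<tau>'
    unfolding dtc_def
  proof (rule INF_greatest, clarify)
    fix \<T> assume T: "is_tas \<T>" "directed \<T>" "strictly_self_assembles \<T> S" and temp: "\<tau>' = temperature \<T>"
    obtain \<alpha> s tm where "assembled \<T> S \<alpha> s tm" by (rule assembledI[OF T])
    then interpret A: assembled \<T> S \<alpha> s tm .
    interpret assembled_layout k b M w e c f \<T> \<alpha> s tm ..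
    have "?N \<le> int (card (tiles \<T>))"
      by (rule many_tiles) (use \<tau>' temp in \<open>simp add: k_def\<close>)
    then show "enat (nat ?N) \<le> enat (card (tiles \<T>))" by simp
  qed
  show ?thesis
    using shape_S finite_S upper less lower by (meson le_less_trans less_le_trans)
qed

end
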